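(* Define integers $a(n)$ by \[ \sum_{n=0}^{\infty} a(n)q^n=\prod_{n=1}^{\infty}\frac{1}{(1-q^{3n})(1-q^n)^3}. \] Then $a(n)\equiv 0\pmod{625}$ whenever $n\equiv 13,\,22,\,31,\,40\pmod{45}$. *)

theory Defs
  imports "HOL-Analysis.Analysis" "HOL-Number_Theory.Cong"
begin

unbundle no vec_syntax
unbundle fps_syntax

text \<open>
  Exactly one integer sequence has the generating function below, so the hypothesis of the
  theorem determines it.  The product is taken over the rationals because \<^typ>\<open>int fps\<close> has no
  division; the coefficients are integers all the same.
\<close>

lemma gen_fun_factor:
  fixes k :: nat
  defines "B \<equiv> {f :: rat fps. f $ 0 = 1 \<and> (\<forall>j. f $ j \<in> \<int>) \<and> (\<forall>j. 0 < j \<longrightarrow> j \<le> k \<longrightarrow> f $ j = 0)}"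
  shows "1 / ((1 - fps_X ^ (3 * (k + 1))) * (1 - fps_X ^ (k + 1)) ^ 3) \<in> B"
proof -
  have mult: "f * g \<in> B" if "f \<in> B" "g \<in> B" for f g
  proof -
    have "(\<Sum>i=0..j. f $ i * g $ (j - i)) = 0" if "0 < j" "j \<le> k" for j
    proof (intro sum.neutral ballI)
      fix i assume "i \<in> {0..j}"
      then show "f $ i * g $ (j - i) = 0"
        using \<open>f \<in> B\<close> \<open>g \<in> B\<close> that by (cases "i = 0") (auto simp: B_def)
    qed
    then show ?thesis
      using that by (auto simp: B_def fps_mult_nth)
  qed
  have geom: "inverse (1 - fps_X ^ d) \<in> B" if d: "k < d" for d :: nat
  proof -
    define g :: "rat fps" where "g = Abs_fps (\<lambda>j. if d dvd j then 1 else 0)"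
    have "(1 - fps_X ^ d) * g = 1"
      using d by (auto simp: fps_eq_iff g_def algebra_simps fps_X_power_mult_nth
                   dvd_minus_self dest: dvd_imp_le)
    then have "inverse (1 - fps_X ^ d) = g"
      by (rule fps_inverse_unique)
    moreover have "g \<in> B"
      using d by (auto simp: g_def B_def dest: dvd_imp_le)
    ultimately show ?thesis
      by simp
  qed
  have eq: "1 / ((1 - fps_X ^ (3 * (k + 1))) * (1 - fps_X ^ (k + 1)) ^ 3) =
      inverse (1 - fps_X ^ (3 * (k + 1)) :: rat fps) * inverse (1 - fps_X ^ (k + 1)) ^ 3"
  proof -
    define u v :: "rat fps" where "u = 1 - fps_X ^ (3 * (k + 1))" and "v = 1 - fps_X ^ (k + 1)"
    have "(u * v ^ 3) $ 0 \<noteq> 0"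
      by (simp add: u_def v_def power3_eq_cube)
    then show ?thesis
      by (simp add: fps_divide_unit fps_inverse_mult fps_inverse_power flip: u_def v_def)
  qed
  show ?thesis
    unfolding eq unfolding power3_eq_cube by (intro mult geom) auto
qed

lemma gen_fun_exists_unique:
  "\<exists>!a :: nat \<Rightarrow> int.
     (\<lambda>k. 1 / ((1 - fps_X ^ (3 * (k + 1))) * (1 - fps_X ^ (k + 1)) ^ 3))
       has_prod (Abs_fps (\<lambda>m. of_int (a m)) :: rat fps)"
proof -
  define f :: "nat \<Rightarrow> rat fps"
    where "f k = 1 / ((1 - fps_X ^ (3 * (k + 1))) * (1 - fps_X ^ (k + 1)) ^ 3)" for k
  have f0: "f k $ 0 = 1" and fint: "f k $ j \<in> \<int>"
    and fvan: "0 < j \<Longrightarrow> j \<le> k \<Longrightarrow> f k $ j = 0" for k j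
    using gen_fun_factor[of k] unfolding f_def by blast+
  define P where "P n = (\<Prod>k\<le>n. f k)" for n
  have Pint: "P n $ j \<in> \<int>" for n j
  proof (induction n arbitrary: j)
    case (Suc n)
    then show ?case
      using fint by (auto simp: P_def fps_mult_nth intro!: Ints_sum Ints_mult)
  qed (simp add: P_def fint)
  have step: "P (Suc n) $ j = P n $ j" if "j \<le> n" for n j
  proof -
    have "P (Suc n) $ j = (\<Sum>i=0..j. P n $ i * f (Suc n) $ (j - i))"
      by (simp add: P_def fps_mult_nth)
    also have "\<dots> = (\<Sum>i\<in>{j}. P n $ i * f (Suc n) $ (j - i))"
      using that by (intro sum.mono_neutral_right) (auto intro!: fvan)
    finally show ?thesis
      by (simp add: f0)
  qed
  have stable: "P n $ j = P j $ j" if "j \<le> n" for n j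
    using that by (induction rule: dec_induct) (auto simp: step)
  have "\<forall>m. \<exists>z. P m $ m = of_int z"
    using Pint by (metis Ints_cases)
  then obtain a :: "nat \<Rightarrow> int" where a: "P m $ m = of_int (a m)" for m
    by metis
  have lim: "P \<longlonglongrightarrow> Abs_fps (\<lambda>m. of_int (a m))"
  proof (rule tendsto_fpsI)
    show "\<forall>\<^sub>F n in sequentially. P n $ j = Abs_fps (\<lambda>m. of_int (a m)) $ j" for j
      using eventually_ge_at_top[of j] by eventually_elim (simp add: stable a)
  qed
  have "of_int (a 0) = (1 :: rat)"
    using a[of 0] by (simp add: P_def f0)
  then have "Abs_fps (\<lambda>m. of_int (a m)) \<noteq> (0 :: rat fps)"
    by (auto simp: fps_eq_iff intro!: exI[of _ 0])
  with lim have ex: "f has_prod Abs_fps (\<lambda>m. of_int (a m))"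
    unfolding has_prod_def raw_has_prod_def P_def by simp
  have uniq: "b = a" if "f has_prod Abs_fps (\<lambda>m. of_int (b m))" for b :: "nat \<Rightarrow> int"
    using has_prod_unique2[OF that ex] by (auto simp: fps_eq_iff)
  show ?thesis
    using ex uniq unfolding f_def by blast
qed

end

theory Submission
  imports Defs
begin

text \<open>
  Write \<open>E\<^sub>k = \<Prod>(1 - q\<^sup>k\<^sup>n)\<close>, \<open>D = q d/dq\<close>, and let \<open>a, b, c\<close> be the cubic theta functions, so that
  \<open>b = E\<^sub>1\<^sup>3 / E\<^sub>3\<close>, \<open>c\<^sup>3 = 27 C\<close> with \<open>C = q E\<^sub>3\<^sup>9 / E\<^sub>1\<^sup>3\<close>, and \<open>a\<^sup>3 = b\<^sup>3 + c\<^sup>3\<close>. Jacobi's identity for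
  \<open>E\<^sub>1\<^sup>3\<close> gives the dissection \<open>b(q) = a(q\<^sup>3) - c(q\<^sup>3)\<close>, and taking the norm of it over the cube roots of unity
  gives the other cubic transformations. Applying them twice to \<open>1 / (E\<^sub>1\<^sup>3 E\<^sub>3)\<close> shows that
  the coefficients of index \<open>9m + 4\<close> have the generating function \<open>27 Y Z\<close> with \<open>Z = E\<^sub>3\<^sup>1\<^sup>5 / E\<^sub>1\<^sup>3\<^sup>5\<close> and \<open>Y\<close> a polynomial in \<open>a\<close> and \<open>C\<close>.
  The same transformations force the differential system
  \<open>D a = a \<beta> + 9 C\<close>, \<open>D C = (a\<^sup>2 + 3 \<beta>) C\<close>, \<open>D \<beta> = \<beta>\<^sup>2 - 3 a C\<close> for \<open>\<beta> = D b / b\<close>, because the error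
  terms are, up to a scalar, invariant under \<open>q \<mapsto> q\<^sup>3\<close>.

  With this system one computes \<open>(12 D + 5)\<^sup>3 (Y Z) = 125 (2 a\<^sup>1\<^sup>0 H Z + 5 R)\<close> where \<open>H = a\<^sup>4 + a C\<close>. Modulo 5 the
  derivative of \<open>a\<^sup>1\<^sup>0 H Z\<close> vanishes, since \<open>Z\<close> is a series in \<open>q\<^sup>5\<close> modulo 5 and \<open>H\<^sup>2 \<equiv> 1\<close>. Comparing the coefficients of
  \<open>q\<^sup>m\<close> with \<open>m\<close> prime to 5, where \<open>12 m + 5\<close> is a unit modulo 5, gives the factor 625.
\<close>

section \<open>Congruence modulo powers of q, and the Euler product\<close>

text \<open>Congruence modulo \<open>fps_X ^ k\<close>. Proving it for every \<open>k\<close>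
  replaces limit arguments for infinite products.\<close>

definition eq_upto :: "nat \<Rightarrow> int fps \<Rightarrow> int fps \<Rightarrow> bool" where
  "eq_upto k f g \<longleftrightarrow> (\<forall>i<k. f $ i = g $ i)"

lemma eq_upto_refl [simp]: "eq_upto k f f"
  by (simp add: eq_upto_def)

lemma eq_upto_sym: "eq_upto k f g \<Longrightarrow> eq_upto k g f"
  by (simp add: eq_upto_def)

lemma eq_upto_trans [trans]: "eq_upto k f g \<Longrightarrow> eq_upto k g h \<Longrightarrow> eq_upto k f h"
  by (simp add: eq_upto_def)

lemma eq_upto_mono: "eq_upto k f g \<Longrightarrow> j \<le> k \<Longrightarrow> eq_upto j f g"
  by (simp add: eq_upto_def)

lemma eq_upto_add: "eq_upto k f g \<Longrightarrow> eq_upto k f' g' \<Longrightarrow> eq_upto k (f + f') (g + g')"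
  by (simp add: eq_upto_def)

lemma eq_upto_diff: "eq_upto k f g \<Longrightarrow> eq_upto k f' g' \<Longrightarrow> eq_upto k (f - f') (g - g')"
  by (simp add: eq_upto_def)

lemma eq_upto_mult: "eq_upto k f g \<Longrightarrow> eq_upto k f' g' \<Longrightarrow> eq_upto k (f * f') (g * g')"
  by (auto simp: eq_upto_def fps_mult_nth intro!: sum.cong)

lemma eq_upto_power: "eq_upto k f g \<Longrightarrow> eq_upto k (f ^ m) (g ^ m)"
  by (induction m) (auto intro: eq_upto_mult)

lemma eq_upto_sum: "(\<And>x. x \<in> S \<Longrightarrow> eq_upto k (f x) (g x)) \<Longrightarrow> eq_upto k (sum f S) (sum g S)"
  by (auto simp: eq_upto_def fps_sum_nth intro!: sum.cong)

lemma eq_upto_imp_eq: "(\<And>k. eq_upto k f g) \<Longrightarrow> f = g"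
  by (auto simp: eq_upto_def fps_eq_iff)

lemma eq_upto_X_power: "k \<le> d \<Longrightarrow> eq_upto k (fps_X ^ d * f) 0"
  by (auto simp: eq_upto_def fps_X_power_mult_nth)

definition euler_part :: "nat \<Rightarrow> int fps" where
  "euler_part n = (\<Prod>i=1..n. 1 - fps_X ^ i)"

text \<open>The diagonal gives the infinite product: a factor \<open>1 - fps_X ^ i\<close> with
  \<open>i > n\<close> no longer affects coefficient \<open>n\<close>.\<close>

definition euler :: "int fps" where
  "euler = Abs_fps (\<lambda>n. euler_part n $ n)"

lemma euler_part_0 [simp]: "euler_part 0 = 1"
  by (simp add: euler_part_def)

lemma euler_part_Suc: "euler_part (Suc n) = euler_part n * (1 - fps_X ^ Suc n)"
  by (simp add: euler_part_def)

lemma euler_part_nth_0 [simp]: "euler_part n $ 0 = 1"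
  by (induction n) (simp_all add: euler_part_Suc)

lemma euler_part_nonzero [simp]: "euler_part n \<noteq> 0"
  by (metis euler_part_nth_0 fps_zero_nth zero_neq_one)

lemma euler_part_eq_upto: "m \<le> n \<Longrightarrow> eq_upto (Suc m) (euler_part n) (euler_part m)"
proof (induction rule: dec_induct)
  case (step n)
  have "eq_upto (Suc m) (euler_part (Suc n)) (euler_part n - 0)"
    unfolding euler_part_Suc right_diff_distrib mult_1_right
    by (rule eq_upto_diff) (use step eq_upto_X_power[of "Suc m" "Suc n"] in \<open>auto simp: mult.commute\<close>)
  with step show ?case
    by (auto intro: eq_upto_trans)
qed simp

lemma euler_eq_upto: "k \<le> Suc n \<Longrightarrow> eq_upto k euler (euler_part n)"
  unfolding eq_upto_def euler_def fps_nth_Abs_fps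
proof (intro allI impI)
  fix i assume "k \<le> Suc n" "i < k"
  then show "euler_part i $ i = euler_part n $ i"
    using euler_part_eq_upto[of i n] by (simp add: eq_upto_def)
qed

lemma euler_nth_0 [simp]: "euler $ 0 = 1"
  by (simp add: euler_def)

definition euler_inv :: "int fps" where
  "euler_inv = fps_right_inverse euler 1"

lemma euler_mult_inv: "euler * euler_inv = 1"
  unfolding euler_inv_def by (rule fps_right_inverse) simp

lemma euler_inv_nth_0 [simp]: "euler_inv $ 0 = 1"
  by (simp add: euler_inv_def)

section \<open>Jacobi's identity for the cube of the Euler product\<close>

text \<open>The q-Pascal rule avoids division. The truncated exponent \<open>n - k\<close> is
  harmless, since for \<open>k > n\<close> its cofactor vanishes.\<close>

fun gauss_binomial :: "nat \<Rightarrow> nat \<Rightarrow> int fps" where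
  "gauss_binomial n 0 = 1"
| "gauss_binomial 0 (Suc k) = 0"
| "gauss_binomial (Suc n) (Suc k) = gauss_binomial n (Suc k) + fps_X ^ (n - k) * gauss_binomial n k"

lemma gauss_binomial_eq_0: "n < k \<Longrightarrow> gauss_binomial n k = 0"
  by (induction n k rule: gauss_binomial.induct) auto

text \<open>The q-factorial formula. The induction rests on
  \<open>1 - x ^ (r + s) = (1 - x ^ s) + x ^ s * (1 - x ^ r)\<close> with \<open>r = Suc k\<close>
  and \<open>s = Suc d\<close>.\<close>

lemma gauss_binomial_euler_part:
  "k \<le> n \<Longrightarrow> gauss_binomial n k * euler_part k * euler_part (n - k) = euler_part n"
proof (induction n k rule: gauss_binomial.induct)
  case (3 n k)
  show ?case
  proof (cases "k = n")
    case True
    with 3 show ?thesis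
      by (simp add: gauss_binomial_eq_0 euler_part_Suc mult.assoc[symmetric])
  next
    case False
    with 3 obtain d where d: "n = Suc (k + d)"
      by (metis Suc_le_mono le_neq_implies_less less_imp_Suc_add)
    define x u v :: "int fps" where "x = fps_X" "u = euler_part k" "v = euler_part d"
    have h1: "gauss_binomial n (Suc k) * (u * (1 - x ^ Suc k)) * v = euler_part n"
      and h2: "gauss_binomial n k * u * (v * (1 - x ^ Suc d)) = euler_part n"
      using 3 d by (simp_all add: euler_part_Suc x_u_v_def Suc_diff_le)
    have rec: "gauss_binomial (Suc n) (Suc k) = gauss_binomial n (Suc k) + x ^ Suc d * gauss_binomial n k"
      unfolding gauss_binomial.simps(3) by (simp only: d x_u_v_def) (simp add: Suc_diff_le)
    have dims: "euler_part (Suc k) = u * (1 - x ^ Suc k)" "euler_part (Suc n - Suc k) = v * (1 - x ^ Suc d)"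
      by (simp_all add: d euler_part_Suc Suc_diff_le x_u_v_def)
    have "gauss_binomial (Suc n) (Suc k) * euler_part (Suc k) * euler_part (Suc n - Suc k)
      = (gauss_binomial n (Suc k) * (u * (1 - x ^ Suc k)) * v) * (1 - x ^ Suc d)
        + x ^ Suc d * (1 - x ^ Suc k) * (gauss_binomial n k * u * (v * (1 - x ^ Suc d)))"
      unfolding rec dims by algebra
    also have "\<dots> = euler_part (Suc n)"
    proof -
      have "fps_X ^ Suc n = x ^ Suc k * x ^ Suc d"
        by (simp add: d x_u_v_def power_add)
      then show ?thesis
        unfolding h1 h2 euler_part_Suc[of n] by (simp add: algebra_simps)
    qed
    finally show ?thesis .
  qed
qed auto

text \<open>Rothe's identity in homogeneous form. Working with polynomials over the power series
  permits differentiation in a variable independent of q.\<close>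

lemma gauss_binomial_theorem:
  fixes x y :: "int fps poly"
  shows "(\<Prod>i<n. x - y * [:fps_X ^ i:]) =
    (\<Sum>k\<le>n. [:(-1) ^ k * fps_X ^ (k choose 2) * gauss_binomial n k:] * y ^ k * x ^ (n - k))"
proof (induction n)
  case (Suc n)
  define c :: "nat \<Rightarrow> nat \<Rightarrow> int fps" where "c m k = (-1) ^ k * fps_X ^ (k choose 2) * gauss_binomial m k" for m k
  have c0: "c m 0 = 1" for m
    by (simp add: c_def binomial_eq_0)
  have cbig: "c n (Suc n) = 0"
    by (simp add: c_def gauss_binomial_eq_0)
  have cS: "c (Suc n) (Suc k) = c n (Suc k) - fps_X ^ n * c n k" if "k \<le> n" for k
  proof -
    have "fps_X ^ (Suc k choose 2) * fps_X ^ (n - k) = (fps_X ^ n * fps_X ^ (k choose 2) :: int fps)"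
      using that by (simp add: numeral_2_eq_2 power_add[symmetric])
    then show ?thesis
      unfolding c_def gauss_binomial.simps by (simp add: algebra_simps)
  qed
  have "(\<Prod>i<Suc n. x - y * [:fps_X ^ i:]) =
      (\<Sum>k\<le>n. [:c n k:] * y ^ k * x ^ (n - k)) * (x - y * [:fps_X ^ n:])"
    using Suc by (simp add: c_def)
  also have "\<dots> = (\<Sum>k\<le>n. [:c n k:] * y ^ k * x ^ (Suc n - k))
      - (\<Sum>k\<le>n. [:fps_X ^ n * c n k:] * y ^ Suc k * x ^ (n - k))"
    unfolding right_diff_distrib sum_distrib_right
    by (intro arg_cong2[where f = minus] sum.cong)
      (auto simp: Suc_diff_le mult_ac)
  also have "(\<Sum>k\<le>n. [:c n k:] * y ^ k * x ^ (Suc n - k)) =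
      (\<Sum>k\<le>Suc n. [:c n k:] * y ^ k * x ^ (Suc n - k))"
    by (simp add: cbig)
  also have "\<dots> = x ^ Suc n + (\<Sum>k\<le>n. [:c n (Suc k):] * y ^ Suc k * x ^ (n - k))"
    by (subst sum.atMost_Suc_shift) (simp add: c0 one_pCons[symmetric])
  also have "\<dots> - (\<Sum>k\<le>n. [:fps_X ^ n * c n k:] * y ^ Suc k * x ^ (n - k))
      = x ^ Suc n + (\<Sum>k\<le>n. [:c (Suc n) (Suc k):] * y ^ Suc k * x ^ (n - k))"
    unfolding add_diff_eq[symmetric] sum_subtractf[symmetric]
    by (intro arg_cong2[where f = plus] sum.cong refl)
      (simp add: cS smult_diff_left left_diff_distrib)
  also have "\<dots> = (\<Sum>k\<le>Suc n. [:c (Suc n) k:] * y ^ k * x ^ (Suc n - k))"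
    by (subst sum.atMost_Suc_shift) (simp add: c0 one_pCons[symmetric])
  finally show ?case
    by (simp add: c_def)
qed (simp add: binomial_eq_0 one_pCons)

lemma two_times_choose_two: "2 * (n choose 2) + n = n * n"
  by (induction n) (auto simp: numeral_2_eq_2)

lemma lessThan_add_split:
  "(\<Sum>k<a + b. f k) = (\<Sum>k<a. f k) + (\<Sum>k<b. f (a + k) :: 'a :: comm_monoid_add)" for a b :: nat
  by (induction b) (auto simp: add.assoc)

lemma prod_lessThan_add_split:
  "(\<Prod>k<a + b. f k) = (\<Prod>k<a. f k) * (\<Prod>k<b. f (a + k) :: 'a :: comm_monoid_mult)" for a b :: nat
  by (induction b) (auto simp: mult.assoc)

declare gauss_binomial.simps(3) [simp del]

lemma gauss_binomial_symmetric:
  assumes "k \<le> n"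
  shows "gauss_binomial n (n - k) = gauss_binomial n k"
proof -
  have "gauss_binomial n (n - k) * (euler_part k * euler_part (n - k)) =
      gauss_binomial n k * (euler_part k * euler_part (n - k))"
    using gauss_binomial_euler_part[OF assms] gauss_binomial_euler_part[of "n - k" n] assms
    by (simp add: mult_ac)
  then show ?thesis
    by simp
qed

lemma euler_part_lessThan: "euler_part n = (\<Prod>i<n. 1 - fps_X ^ Suc i)"
  by (induction n) (simp_all add: euler_part_Suc)

lemma pderiv_sum: "pderiv (sum f S) = (\<Sum>x\<in>S. pderiv (f x))"
  by (induction S rule: infinite_finite_induct) (auto simp: pderiv_add)

text \<open>Take \<open>2 * n + 1\<close> factors with \<open>x\<close> equal to q to the power
  \<open>n\<close>, differentiate in \<open>y\<close> and set \<open>y = 1\<close>. The middle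
  factor vanishes there, so on the product side only the term with its derivative survives.\<close>

lemma finite_jacobi:
  "(\<Sum>j\<le>n. of_int ((-1) ^ j * (2 * int j + 1)) * fps_X ^ (Suc j choose 2) * gauss_binomial (2 * n + 1) (n - j))
     = euler_part n ^ 2"
proof -
  define X :: "int fps" where "X = fps_X"
  define N where "N = Suc n + n"
  define c where "c k = (-1) ^ k * X ^ (k choose 2) * gauss_binomial N k" for k
  define y :: "int fps poly" where "y = [:0, 1:]"
  define F where "F i = [:X ^ n:] - y * [:X ^ i:]" for i
  \<comment> \<open>The power of q on the product side: \<open>n choose 2\<close> from the factors
    below the middle, \<open>n * n\<close> from those above, \<open>n\<close> from the derivative of
    the middle one.\<close>
  define e0 where "e0 = (n choose 2) + n * n + n"
  define t where "t k = of_nat k * c k * X ^ (n * (N - k))" for k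
  have F1: "poly (F i) 1 = X ^ n - X ^ i" for i
    by (simp add: F_def y_def)
  have low: "(\<Prod>i<n. (X ^ n - X ^ i)) = (-1) ^ n * X ^ (n choose 2) * euler_part n"
  proof -
    have "(\<Prod>i<n. (X ^ n - X ^ i)) = (\<Prod>i<n. (X ^ n - X ^ (n - Suc i)))"
      by (rule prod.nat_diff_reindex[symmetric])
    also have "\<dots> = (\<Prod>i<n. - (X ^ (n - Suc i) * (1 - X ^ Suc i)))"
    proof (intro prod.cong refl)
      fix i assume "i \<in> {..<n}"
      then have "n = (n - Suc i) + Suc i"
        by simp
      then have "X ^ n = X ^ (n - Suc i) * X ^ Suc i"
        by (metis power_add)
      then show "X ^ n - X ^ (n - Suc i) = - (X ^ (n - Suc i) * (1 - X ^ Suc i))"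
        by (simp only: right_diff_distrib mult_1_right minus_diff_eq)
    qed
    also have "\<dots> = (-1) ^ n * (\<Prod>i<n. X ^ (n - Suc i)) * euler_part n"
      by (simp add: prod_uminus prod.distrib euler_part_lessThan X_def)
    also have "(\<Prod>i<n. X ^ (n - Suc i)) = (\<Prod>i<n. X ^ i)"
      by (rule prod.nat_diff_reindex)
    also have "\<dots> = X ^ (n choose 2)"
      by (simp flip: power_sum) (metis Sum_Ico_nat atLeast0LessThan choose_two mult_zero_left diff_zero)
    finally show ?thesis .
  qed
  have high: "(\<Prod>i<n. (X ^ n - X ^ (Suc n + i))) = X ^ (n * n) * euler_part n"
  proof -
    have "(\<Prod>i<n. (X ^ n - X ^ (Suc n + i))) = (\<Prod>i<n. X ^ n * (1 - X ^ Suc i))"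
      by (intro prod.cong refl) (simp add: algebra_simps power_add)
    then show ?thesis
      by (simp add: prod.distrib euler_part_lessThan X_def power_mult)
  qed
  have "(\<Prod>i<N. F i) = (\<Prod>i<n. F i) * (\<Prod>i<n. F (Suc n + i)) * F n"
    unfolding N_def prod_lessThan_add_split by (simp add: mult_ac)
  then have "poly (pderiv (\<Prod>i<N. F i)) 1 =
      poly (\<Prod>i<n. F i) 1 * poly (\<Prod>i<n. F (Suc n + i)) 1 * poly (pderiv (F n)) 1"
    by (simp add: pderiv_mult F1)
  also have "poly (pderiv (F n)) 1 = - (X ^ n)"
    by (simp add: F_def y_def pderiv_pCons)
  finally have lhs: "poly (pderiv (\<Prod>i<N. F i)) 1 = - ((-1) ^ n) * X ^ e0 * euler_part n ^ 2"
    by (simp only: poly_prod F1 low high) (simp add: e0_def power_add power2_eq_square mult_ac)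
  have "(\<Prod>i<N. F i) = (\<Sum>k\<le>N. [:c k * X ^ (n * (N - k)):] * y ^ k)"
    unfolding F_def X_def gauss_binomial_theorem c_def
    by (intro sum.cong refl) (simp add: mult_ac poly_const_pow power_mult)
  also have "pderiv \<dots> = (\<Sum>k\<le>N. [:c k * X ^ (n * (N - k)):] * (of_nat k * y ^ (k - 1)))"
    unfolding pderiv_sum
    by (intro sum.cong refl)
       (auto simp: pderiv_smult pderiv_mult pderiv_power pderiv_pCons y_def of_nat_poly mult_ac)
  finally have rhs: "poly (pderiv (\<Prod>i<N. F i)) 1 = (\<Sum>k\<le>N. t k)"
    by (simp add: poly_sum y_def t_def mult_ac)
  \<comment> \<open>The two terms have the same Gaussian binomial and power of q but opposite signs,
    so the weights \<open>n - j\<close> and \<open>Suc n + j\<close> combine to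
    \<open>2 * j + 1\<close>.\<close>
  have pair: "t (n - j) + t (Suc n + j) = - ((-1) ^ n) * X ^ e0 *
      (of_int ((-1) ^ j * (2 * int j + 1)) * X ^ (Suc j choose 2) * gauss_binomial N (n - j))" if "j \<le> n" for j
  proof -
    obtain d where d: "n = j + d"
      using \<open>j \<le> n\<close> le_Suc_ex by blast
    have e1: "(n - j choose 2) + n * (N - (n - j)) = e0 + (Suc j choose 2)"
      using two_times_choose_two[of d] two_times_choose_two[of "Suc j"] two_times_choose_two[of n]
      by (simp add: N_def e0_def d algebra_simps)
    have e2: "(Suc n + j choose 2) + n * (N - (Suc n + j)) = e0 + (Suc j choose 2)"
      using two_times_choose_two[of "Suc n + j"] two_times_choose_two[of "Suc j"] two_times_choose_two[of n]
      by (simp add: N_def e0_def d algebra_simps)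
    have g: "gauss_binomial N (Suc n + j) = gauss_binomial N (n - j)"
    proof -
      have "Suc n + j \<le> N" "N - (Suc n + j) = n - j"
        using that by (simp_all add: N_def)
      then show ?thesis
        using gauss_binomial_symmetric by metis
    qed
    have s1: "(-1) ^ (n - j) = ((-1) ^ n * (-1) ^ j :: int fps)"
      by (simp add: d power_add mult.commute)
    have t1: "t (n - j) = of_nat (n - j) * ((-1) ^ n * (-1) ^ j) *
        X ^ (e0 + (Suc j choose 2)) * gauss_binomial N (n - j)"
      unfolding t_def c_def e1[symmetric] power_add s1 by (simp only: mult_ac)
    have t2: "t (Suc n + j) = - of_nat (Suc n + j) * ((-1) ^ n * (-1) ^ j) *
        X ^ (e0 + (Suc j choose 2)) * gauss_binomial N (n - j)"
      unfolding t_def c_def g e2[symmetric] power_add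
      by (simp only: mult_ac power_Suc mult_minus_left mult_minus_right mult_1_left)
    show ?thesis
      unfolding t1 t2 by (simp add: d power_add algebra_simps)
  qed
  have "{..N} = {..<Suc n + Suc n}"
    by (auto simp: N_def)
  then have "(\<Sum>k\<le>N. t k) = (\<Sum>k<Suc n. t (n - k)) + (\<Sum>k<Suc n. t (Suc n + k))"
    using sum.nat_diff_reindex[of t "Suc n"] by (simp only: lessThan_add_split diff_Suc_Suc)
  also have "\<dots> = (\<Sum>j\<le>n. t (n - j) + t (Suc n + j))"
    by (simp only: lessThan_Suc_atMost sum.distrib)
  also have "\<dots> = - ((-1) ^ n) * X ^ e0 * (\<Sum>j\<le>n. of_int ((-1) ^ j * (2 * int j + 1)) *
      X ^ (Suc j choose 2) * gauss_binomial N (n - j))"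
    unfolding sum_distrib_left by (intro sum.cong refl pair) simp
  finally have "- ((-1) ^ n) * X ^ e0 * (\<Sum>j\<le>n. of_int ((-1) ^ j * (2 * int j + 1)) *
      X ^ (Suc j choose 2) * gauss_binomial N (n - j)) = - ((-1) ^ n) * X ^ e0 * euler_part n ^ 2"
    using lhs rhs by simp
  moreover have "- ((-1) ^ n) * X ^ e0 \<noteq> 0"
    by (simp add: X_def)
  ultimately have "(\<Sum>j\<le>n. of_int ((-1) ^ j * (2 * int j + 1)) * X ^ (Suc j choose 2) * gauss_binomial N (n - j))
      = euler_part n ^ 2"
    unfolding mult_cancel_left by blast
  moreover have "2 * n + 1 = N"
    by (simp add: N_def)
  ultimately show ?thesis
    by (simp only: X_def)
qed

text \<open>Multiply \<open>finite_jacobi\<close> by \<open>euler\<close>. To the order considered,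
  \<open>euler * g j\<close> is 1 for \<open>j \<le> m\<close>, and terms with \<open>j > m\<close>
  begin too late to count.\<close>

theorem jacobi_partial:
  "eq_upto (Suc m) (euler ^ 3) (\<Sum>j\<le>m. of_int ((-1) ^ j * (2 * int j + 1)) * fps_X ^ (Suc j choose 2))"
proof -
  \<comment> \<open>Doubling ensures \<open>n - j \<ge> m\<close> for all \<open>j \<le> m\<close>,
    so each partial product below already agrees with \<open>euler\<close>.\<close>
  define n where "n = 2 * m"
  define s where "s j = of_int ((-1) ^ j * (2 * int j + 1)) * (fps_X ^ (Suc j choose 2) :: int fps)" for j
  define g where "g j = gauss_binomial (2 * n + 1) (n - j)" for j
  have big: "eq_upto (Suc m) (s j * f) 0" if "m < j" for j f
  proof -
    have "Suc m \<le> Suc j choose 2"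
      using that by (simp add: numeral_2_eq_2)
    from eq_upto_X_power[OF this, of "of_int ((-1) ^ j * (2 * int j + 1)) * f"] show ?thesis
      by (simp add: s_def mult_ac)
  qed
  have small: "eq_upto (Suc m) (euler * g j) 1" if "j \<le> m" for j
  proof -
    have "eq_upto (Suc m) (g j * euler * euler) (g j * euler_part (n - j) * euler_part (n + 1 + j))"
      using that by (intro eq_upto_mult euler_eq_upto) (auto simp: n_def)
    also have "g j * euler_part (n - j) * euler_part (n + 1 + j) = euler_part (2 * n + 1)"
    proof -
      have "n - j \<le> 2 * n + 1" "2 * n + 1 - (n - j) = n + 1 + j"
        using that by (auto simp: n_def)
      then show ?thesis
        using gauss_binomial_euler_part unfolding g_def by metis
    qed
    also have "eq_upto (Suc m) (euler_part (2 * n + 1)) euler"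
      by (rule eq_upto_sym, rule euler_eq_upto) (auto simp: n_def)
    finally have "eq_upto (Suc m) (g j * euler * euler * euler_inv) (euler * euler_inv)"
      by (intro eq_upto_mult) auto
    then show ?thesis
      by (simp add: mult.assoc euler_mult_inv) (simp add: mult.commute)
  qed
  have "eq_upto (Suc m) (euler ^ 3) (euler * euler_part n ^ 2)"
    unfolding power3_eq_cube power2_eq_square mult.assoc
    by (intro eq_upto_mult euler_eq_upto) (auto simp: n_def)
  also have "euler * euler_part n ^ 2 = (\<Sum>j\<le>n. s j * (euler * g j))"
    unfolding finite_jacobi[symmetric] sum_distrib_left s_def g_def
    by (intro sum.cong refl) (simp add: mult_ac)
  also have "eq_upto (Suc m) \<dots> (\<Sum>j\<le>n. if j \<le> m then s j * 1 else 0)"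
  proof (rule eq_upto_sum)
    fix j
    show "eq_upto (Suc m) (s j * (euler * g j)) (if j \<le> m then s j * 1 else 0)"
      using eq_upto_mult[OF eq_upto_refl small, of j "s j"] big[of j] by (cases "j \<le> m") auto
  qed
  also have "(\<Sum>j\<le>n. if j \<le> m then s j * 1 else 0) = (\<Sum>j\<le>m. s j)"
    by (rule sum.mono_neutral_cong_right) (auto simp: n_def)
  finally show ?thesis
    by (simp add: s_def)
qed

section \<open>Dissection modulo 3\<close>

definition dil3 :: "int fps \<Rightarrow> int fps" where
  "dil3 f = f oo fps_X ^ 3"

lemma dil3_nth: "dil3 f $ n = (if 3 dvd n then f $ (n div 3) else 0)"
proof -
  have "dil3 f $ n = (\<Sum>i=0..n. if i = n div 3 \<and> 3 dvd n then f $ i else 0)"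
    unfolding dil3_def fps_compose_nth power_mult[symmetric] fps_X_power_nth
    by (intro sum.cong) auto
  also have "\<dots> = (if 3 dvd n then f $ (n div 3) else 0)"
    by (auto simp: sum.delta)
  finally show ?thesis .
qed

lemma dil3_add [simp]: "dil3 (f + g) = dil3 f + dil3 g"
  by (simp add: dil3_def fps_compose_add_distrib)

lemma dil3_diff [simp]: "dil3 (f - g) = dil3 f - dil3 g"
  by (simp add: dil3_def fps_compose_sub_distrib)

lemma dil3_uminus [simp]: "dil3 (- f) = - dil3 f"
  by (auto simp: fps_eq_iff dil3_nth)

lemma dil3_mult [simp]: "dil3 (f * g) = dil3 f * dil3 g"
  by (simp add: dil3_def fps_compose_mult_distrib)

lemma dil3_1 [simp]: "dil3 1 = 1"
  by (simp add: dil3_def)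

lemma dil3_power [simp]: "dil3 (f ^ m) = dil3 f ^ m"
  by (induction m) simp_all

lemma dil3_numeral [simp]: "dil3 (numeral m) = numeral m"
  by (simp add: dil3_def)

lemma dil3_X [simp]: "dil3 fps_X = fps_X ^ 3"
  by (simp add: dil3_def)

lemma dil3_inject [simp]: "dil3 f = dil3 g \<longleftrightarrow> f = g"
proof
  assume *: "dil3 f = dil3 g"
  show "f = g"
  proof (rule fps_ext)
    fix n show "f $ n = g $ n"
      using arg_cong[OF *, of "\<lambda>h. h $ (3 * n)"] by (simp add: dil3_nth)
  qed
qed simp

lemma eq_upto_dil3: "eq_upto k f g \<Longrightarrow> eq_upto k (dil3 f) (dil3 g)"
  by (auto simp: eq_upto_def dil3_nth)

definition sec3 :: "nat \<Rightarrow> int fps \<Rightarrow> int fps" where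
  "sec3 r f = Abs_fps (\<lambda>n. if n mod 3 = r then f $ n else 0)"

lemma sec3_nth: "sec3 r f $ n = (if n mod 3 = r then f $ n else 0)"
  by (simp add: sec3_def)

lemma sec3_add: "sec3 r (f + g) = sec3 r f + sec3 r g"
  by (auto simp: fps_eq_iff sec3_nth)

lemma sec3_sum: "sec3 r (sum f S) = (\<Sum>x\<in>S. sec3 r (f x))"
  by (auto simp: fps_eq_iff sec3_nth fps_sum_nth)

lemma sec3_of_int_X_power: "sec3 r (of_int c * fps_X ^ d) = (if d mod 3 = r then of_int c * fps_X ^ d else 0)"
  by (auto simp: fps_eq_iff sec3_nth fps_X_power_mult_right_nth fps_nth_of_int)

lemma sec3_decompose: "f = sec3 0 f + sec3 1 f + sec3 2 f"
proof -
  have "n mod 3 = 0 \<or> n mod 3 = 1 \<or> n mod 3 = 2" for n :: nat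
    by presburger
  then show ?thesis
    by (auto simp: fps_eq_iff sec3_nth)
qed

lemma sec3_mult_sec3:
  "sec3 r (sec3 i f * sec3 j g) = (if (i + j) mod 3 = r then sec3 i f * sec3 j g else 0)"
proof -
  have *: "(\<Sum>k=0..n. sec3 i f $ k * sec3 j g $ (n - k)) = 0" if "n mod 3 \<noteq> (i + j) mod 3" for n
  proof (rule sum.neutral, safe)
    fix k assume "k \<in> {0..n}"
    then have "n = k + (n - k)"
      by simp
    then have "n mod 3 = (k mod 3 + (n - k) mod 3) mod 3"
      by (metis mod_add_eq)
    then show "sec3 i f $ k * sec3 j g $ (n - k) = 0"
      using that by (auto simp: sec3_nth)
  qed
  show ?thesis
    using * by (auto simp: fps_eq_iff sec3_nth[of r] fps_mult_nth)
qed

lemma sec3_mult: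
  "sec3 0 (f * g) = sec3 0 f * sec3 0 g + sec3 1 f * sec3 2 g + sec3 2 f * sec3 1 g"
  "sec3 1 (f * g) = sec3 0 f * sec3 1 g + sec3 1 f * sec3 0 g + sec3 2 f * sec3 2 g"
  "sec3 2 (f * g) = sec3 0 f * sec3 2 g + sec3 1 f * sec3 1 g + sec3 2 f * sec3 0 g"
proof -
  have "f * g = (sec3 0 f + sec3 1 f + sec3 2 f) * (sec3 0 g + sec3 1 g + sec3 2 g)"
    by (rule arg_cong2[where f = times]) (rule sec3_decompose)+
  then have *: "sec3 r (f * g) = sec3 r (sec3 0 f * sec3 0 g) + sec3 r (sec3 0 f * sec3 1 g) + sec3 r (sec3 0 f * sec3 2 g)
      + sec3 r (sec3 1 f * sec3 0 g) + sec3 r (sec3 1 f * sec3 1 g) + sec3 r (sec3 1 f * sec3 2 g)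
      + sec3 r (sec3 2 f * sec3 0 g) + sec3 r (sec3 2 f * sec3 1 g) + sec3 r (sec3 2 f * sec3 2 g)" for r
    by (simp only: sec3_add ring_distribs add_ac)
  show "sec3 0 (f * g) = sec3 0 f * sec3 0 g + sec3 1 f * sec3 2 g + sec3 2 f * sec3 1 g"
    "sec3 1 (f * g) = sec3 0 f * sec3 1 g + sec3 1 f * sec3 0 g + sec3 2 f * sec3 2 g"
    "sec3 2 (f * g) = sec3 0 f * sec3 2 g + sec3 1 f * sec3 1 g + sec3 2 f * sec3 0 g"
    unfolding * by (simp_all add: sec3_mult_sec3)
qed

lemma eq_upto_sec3: "eq_upto k f g \<Longrightarrow> eq_upto k (sec3 r f) (sec3 r g)"
  by (auto simp: eq_upto_def sec3_nth)

section \<open>The norm over the cube roots of unity\<close>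

text \<open>Over the complex numbers this is the product of \<open>f(\<omega>\<^sup>j q)\<close> for the three cube roots of unity
  \<open>\<omega>\<^sup>j\<close>.\<close>
definition norm3 :: "int fps \<Rightarrow> int fps" where
  "norm3 f = sec3 0 f ^ 3 + sec3 1 f ^ 3 + sec3 2 f ^ 3 - 3 * (sec3 0 f * sec3 1 f * sec3 2 f)"

lemma norm3_mult: "norm3 (f * g) = norm3 f * norm3 g"
proof -
  \<comment> \<open>Multiplicativity of the 3 by 3 circulant determinant; the sections of a product
    multiply like circulant matrices.\<close>
  have alg: "(a * x + b * z + c * y) ^ 3 + (a * y + b * x + c * z) ^ 3 + (a * z + b * y + c * x) ^ 3
      - 3 * ((a * x + b * z + c * y) * (a * y + b * x + c * z) * (a * z + b * y + c * x))
      = (a ^ 3 + b ^ 3 + c ^ 3 - 3 * (a * b * c)) * (x ^ 3 + y ^ 3 + z ^ 3 - 3 * (x * y * z))"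
    for a b c x y z :: "int fps"
    by algebra
  show ?thesis
    unfolding norm3_def sec3_mult alg ..
qed

lemma eq_upto_norm3: "eq_upto k f g \<Longrightarrow> eq_upto k (norm3 f) (norm3 g)"
  unfolding norm3_def
  by (intro eq_upto_add eq_upto_diff eq_upto_mult eq_upto_power eq_upto_sec3 eq_upto_refl)

lemma norm3_1 [simp]: "norm3 1 = 1"
proof -
  have "sec3 0 1 = 1" "sec3 1 1 = 0" "sec3 2 1 = 0"
    by (auto simp: fps_eq_iff sec3_nth)
  then show ?thesis
    by (simp add: norm3_def)
qed

lemma norm3_factor:
  assumes "0 < i"
  shows "norm3 (1 - fps_X ^ i) = (if 3 dvd i then (1 - fps_X ^ i) ^ 3 else 1 - (fps_X ^ i) ^ 3)"
proof -
  have s: "sec3 r (1 - fps_X ^ i) = (if r = 0 then 1 else 0) - (if i mod 3 = r then fps_X ^ i else 0)" if "r < 3" for r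
    using that by (auto simp: fps_eq_iff sec3_nth)
  have "i mod 3 = 0 \<or> i mod 3 = 1 \<or> i mod 3 = 2"
    by presburger
  then show ?thesis
    by (auto simp: norm3_def s dvd_eq_mod_eq_0)
qed

text \<open>Factors with index prime to 3 have norm \<open>1 - (fps_X ^ i) ^ 3\<close>. Those with
  index divisible by 3 are cubed instead, and the extra factor on the left supplies the missing
  terms of \<open>dil3 (euler_part (3 * m))\<close>.\<close>

lemma norm3_euler_part:
  "norm3 (euler_part (3 * m)) * dil3 (dil3 (euler_part m)) = dil3 (euler_part (3 * m)) * dil3 (euler_part m) ^ 3"
proof (induction m)
  case (Suc m)
  define x :: "int fps" where "x = fps_X"
  define k where "k = 3 * m"
  have three: "3 * Suc m = Suc (Suc (Suc k))"
    by (simp add: k_def)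
  have nd: "\<not> 3 dvd Suc k" "\<not> 3 dvd Suc (Suc k)" "3 dvd Suc (Suc (Suc k))"
    unfolding k_def by presburger+
  have p: "(fps_X ^ 3) ^ Suc m = x ^ Suc (Suc (Suc k))" "((fps_X ^ 3) ^ 3) ^ Suc m = (x ^ Suc (Suc (Suc k))) ^ 3"
    by (simp_all only: three[symmetric] power_mult[symmetric] x_def) (simp_all add: mult.commute)
  have q: "(fps_X ^ 3) ^ j = (x ^ j) ^ 3" for j
    by (simp only: power_mult[symmetric] x_def mult.commute)
  define u v w :: "int fps" where "u = x ^ Suc k" "v = x ^ Suc (Suc k)" "w = x ^ Suc (Suc (Suc k))"
  have nf: "norm3 (1 - fps_X ^ Suc k) = 1 - u ^ 3" "norm3 (1 - fps_X ^ Suc (Suc k)) = 1 - v ^ 3"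
    "norm3 (1 - fps_X ^ Suc (Suc (Suc k))) = (1 - w) ^ 3"
    using nd by (simp_all add: norm3_factor u_v_w_def x_def del: power_Suc)
  have "norm3 (euler_part (3 * Suc m)) * dil3 (dil3 (euler_part (Suc m)))
      = (norm3 (euler_part k) * dil3 (dil3 (euler_part m))) * (1 - u ^ 3) * (1 - v ^ 3) * (1 - w) ^ 3 * (1 - w ^ 3)"
    unfolding three euler_part_Suc norm3_mult dil3_mult dil3_diff dil3_power dil3_1 dil3_X
    by (simp only: nf p u_v_w_def(3)[symmetric] mult_ac)
  also have "\<dots> = dil3 (euler_part (3 * Suc m)) * dil3 (euler_part (Suc m)) ^ 3"
    unfolding three euler_part_Suc[of k] euler_part_Suc[of "Suc k"] euler_part_Suc[of "Suc (Suc k)"]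
      euler_part_Suc[of m] dil3_mult dil3_diff dil3_power dil3_1 dil3_X
      p q[of "Suc k"] q[of "Suc (Suc k)"] q[of "Suc (Suc (Suc k))"] u_v_w_def[symmetric]
    by (simp only: Suc[folded k_def] power_mult_distrib mult_ac)
  finally show ?case .
qed simp

lemma norm3_euler: "norm3 euler * dil3 (dil3 euler) = dil3 euler ^ 4"
proof (rule eq_upto_imp_eq)
  fix k
  have "eq_upto k (norm3 euler * dil3 (dil3 euler)) (norm3 (euler_part (3 * k)) * dil3 (dil3 (euler_part k)))"
    by (intro eq_upto_mult eq_upto_norm3 eq_upto_dil3 euler_eq_upto) auto
  also have "eq_upto k \<dots> (dil3 euler * dil3 euler ^ 3)"
    unfolding norm3_euler_part
    by (rule eq_upto_sym, intro eq_upto_mult eq_upto_power eq_upto_dil3 euler_eq_upto) auto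
  also have "dil3 euler * dil3 euler ^ 3 = dil3 euler ^ 4"
    by (simp add: eval_nat_numeral)
  finally show "eq_upto k (norm3 euler * dil3 (dil3 euler)) (dil3 euler ^ 4)" .
qed

section \<open>Dissection of the cube of the Euler product\<close>

text \<open>This is \<open>E\<^sub>1\<close> times the cubic theta function
  \<open>a\<close>.\<close>

definition cubic_A :: "int fps" where
  "cubic_A = Abs_fps (\<lambda>n. (euler ^ 3) $ (3 * n))"

lemma sec3_0_euler_cube: "sec3 0 (euler ^ 3) = dil3 cubic_A"
  by (auto simp: fps_eq_iff sec3_nth dil3_nth cubic_A_def)

text \<open>Triangular numbers are 0 or 1 modulo 3, and the latter occurs exactly for index 1 modulo
  3.\<close>

lemma triangle_split:
  "Suc (3 * k + 1) choose 2 = 9 * (Suc k choose 2) + 1"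
  "(Suc (3 * k) choose 2) mod 3 = 0" "(Suc (3 * k + 2) choose 2) mod 3 = 0"
proof -
  have h: "c mod 3 = 0" if "2 * c = 3 * t" for c t :: nat
    using that by presburger
  show "Suc (3 * k + 1) choose 2 = 9 * (Suc k choose 2) + 1"
    using two_times_choose_two[of "Suc (3 * k + 1)"] two_times_choose_two[of "Suc k"] by (simp add: algebra_simps)
  show "(Suc (3 * k) choose 2) mod 3 = 0" "(Suc (3 * k + 2) choose 2) mod 3 = 0"
    using h[of _ "k + 3 * k * k"] h[of _ "2 + 5 * k + 3 * k * k"]
      two_times_choose_two[of "Suc (3 * k)"] two_times_choose_two[of "Suc (3 * k + 2)"]
    by (simp_all add: algebra_simps)
qed

lemma sum_lessThan_mult_3:
  "(\<Sum>j<3 * m. f j) = (\<Sum>k<m. f (3 * k) + f (3 * k + 1) + f (3 * k + 2) :: 'a :: comm_monoid_add)" for m :: nat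
proof (induction m)
  case (Suc m)
  have "3 * Suc m = Suc (Suc (Suc (3 * m)))"
    by simp
  then show ?case
    using Suc by (simp only: sum.lessThan_Suc) (simp add: add.assoc)
qed simp

text \<open>The terms \<open>j = 3 * k + 1\<close> of Jacobi's series reproduce that series in
  \<open>q\<^sup>9\<close>, because \<open>2 * j + 1 = 3 * (2 * k + 1)\<close> and the sign
  flips.\<close>

lemma sec3_12_euler_cube:
  "sec3 1 (euler ^ 3) = - 3 * fps_X * dil3 (dil3 euler) ^ 3" "sec3 2 (euler ^ 3) = 0"
proof -
  define s where "s j = of_int ((-1) ^ j * (2 * int j + 1)) * (fps_X ^ (Suc j choose 2) :: int fps)" for j
  have J: "eq_upto m (euler ^ 3) (\<Sum>j<m. s j)" for m
  proof (cases m)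
    case (Suc l)
    show ?thesis
      unfolding Suc lessThan_Suc_atMost s_def by (rule jacobi_partial)
  qed (simp add: eq_upto_def)
  have not2: "(9 * j + 1) mod 3 = (1 :: nat)" for j :: nat
    by presburger
  have s1: "sec3 1 (s (3 * k)) = 0" "sec3 1 (s (3 * k + 2)) = 0"
    "sec3 2 (s (3 * k)) = 0" "sec3 2 (s (3 * k + 2)) = 0" "sec3 2 (s (3 * k + 1)) = 0" for k
    unfolding s_def sec3_of_int_X_power triangle_split using not2 by simp_all
  have s2: "sec3 1 (s (3 * k + 1)) = - 3 * fps_X * dil3 (dil3 (s k))" for k
  proof -
    have i: "dil3 (of_int c) = of_int c" for c
      by (auto simp: fps_eq_iff dil3_nth fps_nth_of_int)
    have "sec3 1 (s (3 * k + 1)) = s (3 * k + 1)"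
      unfolding s_def sec3_of_int_X_power triangle_split not2 by simp
    also have "\<dots> = of_int (- 3 * ((-1) ^ k * (2 * int k + 1))) * (fps_X * ((fps_X ^ 3) ^ 3) ^ (Suc k choose 2))"
    proof -
      have "(-1) ^ (3 * k + 1) * (2 * int (3 * k + 1) + 1) = - 3 * ((-1) ^ k * (2 * int k + 1))"
        by (simp add: uminus_power_if algebra_simps)
      moreover have "fps_X ^ (9 * (Suc k choose 2) + 1) = (fps_X * ((fps_X ^ 3) ^ 3) ^ (Suc k choose 2) :: int fps)"
        by (simp only: power_mult[symmetric] power_add) (simp add: mult_ac)
      ultimately show ?thesis
        unfolding s_def triangle_split by (simp only:)
    qed
    also have "\<dots> = - 3 * fps_X * dil3 (dil3 (s k))"
      unfolding s_def dil3_mult dil3_power dil3_X i of_int_mult of_int_minus of_int_numeral by (simp only: mult_ac)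
    finally show ?thesis .
  qed
  have E: "eq_upto k (euler ^ 3) (\<Sum>j<3 * k. s j)" for k
    by (rule eq_upto_mono[OF J]) simp
  have F: "eq_upto k (sec3 r (euler ^ 3)) (\<Sum>j<k. sec3 r (s (3 * j)) + sec3 r (s (3 * j + 1)) + sec3 r (s (3 * j + 2)))" for r k
    using eq_upto_sec3[OF E, of k r] unfolding sum_lessThan_mult_3 sec3_sum sec3_add .
  show "sec3 2 (euler ^ 3) = 0"
    by (rule eq_upto_imp_eq) (use F[of _ 2] s1 in simp)
  show "sec3 1 (euler ^ 3) = - 3 * fps_X * dil3 (dil3 euler) ^ 3"
  proof (rule eq_upto_imp_eq)
    fix k
    have tt: "dil3 (dil3 (\<Sum>j<k. s j)) = (\<Sum>j<k. dil3 (dil3 (s j)))"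
      by (induction k) (auto simp: fps_eq_iff dil3_nth)
    have "eq_upto k (sec3 1 (euler ^ 3)) (- 3 * fps_X * dil3 (dil3 (\<Sum>j<k. s j)))"
      using F[of k 1] s1 unfolding tt sum_distrib_left s2 by simp
    also have "eq_upto k \<dots> (- 3 * fps_X * dil3 (dil3 (euler ^ 3)))"
      by (intro eq_upto_mult eq_upto_refl eq_upto_dil3 eq_upto_sym[OF J])
    finally show "eq_upto k (sec3 1 (euler ^ 3)) (- 3 * fps_X * dil3 (dil3 euler) ^ 3)"
      by simp
  qed
qed

lemma euler_cube_dissection: "euler ^ 3 = dil3 cubic_A - 3 * fps_X * dil3 (dil3 euler) ^ 3"
  using sec3_decompose[of "euler ^ 3"] unfolding sec3_0_euler_cube sec3_12_euler_cube by simp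

text \<open>Compute the norm of \<open>euler ^ 3\<close> twice: from its dissection, whose last
  section is 0, and from \<open>norm3_euler\<close>. Then undo \<open>dil3\<close>.\<close>

lemma cubic_A_cube: "(cubic_A ^ 3 - 27 * fps_X * dil3 euler ^ 9) * dil3 euler ^ 3 = euler ^ 12"
proof -
  have "norm3 (euler ^ 3) = dil3 cubic_A ^ 3 - 27 * fps_X ^ 3 * (dil3 (dil3 euler)) ^ 9"
    unfolding norm3_def sec3_0_euler_cube sec3_12_euler_cube by (simp add: power_mult_distrib flip: power_mult)
  moreover have "norm3 (euler ^ 3) * dil3 (dil3 euler) ^ 3 = dil3 euler ^ 12"
    unfolding power3_eq_cube norm3_mult
    using arg_cong[OF norm3_euler, of "\<lambda>x. x ^ 3"] by (simp add: power3_eq_cube mult_ac flip: power_mult)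
  ultimately have "dil3 ((cubic_A ^ 3 - 27 * fps_X * dil3 euler ^ 9) * dil3 euler ^ 3) = dil3 (euler ^ 12)"
    by simp
  then show ?thesis
    unfolding dil3_inject .
qed

section \<open>The cubic theta functions and their derivatives\<close>

definition qd :: "int fps \<Rightarrow> int fps" where
  "qd f = fps_X * fps_deriv f"

lemma qd_nth: "qd f $ n = int n * f $ n"
  by (cases n) (simp_all add: qd_def)

lemma qd_add [simp]: "qd (f + g) = qd f + qd g"
  and qd_diff [simp]: "qd (f - g) = qd f - qd g"
  and qd_mult [simp]: "qd (f * g) = f * qd g + qd f * g"
  and qd_numeral [simp]: "qd (numeral k) = 0"
  and qd_1 [simp]: "qd 1 = 0"
  by (simp_all add: qd_def algebra_simps)

lemma qd_power [simp]: "qd (f ^ numeral k) = numeral k * f ^ (numeral k - 1) * qd f"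
  by (simp add: qd_def fps_deriv_power' mult_ac)

lemma qd_dil3 [simp]: "qd (dil3 f) = 3 * dil3 (qd f)"
  by (auto simp: fps_eq_iff qd_nth dil3_nth numeral_fps_const)

text \<open>A relation instead of a quotient, so that it also applies to \<open>fps_X\<close>, which
  is not invertible.\<close>

definition log_deriv :: "int fps \<Rightarrow> int fps \<Rightarrow> bool" where
  "log_deriv f u \<longleftrightarrow> qd f = u * f"

lemma log_deriv_mult: "log_deriv f u \<Longrightarrow> log_deriv g v \<Longrightarrow> log_deriv (f * g) (u + v)"
  by (simp add: log_deriv_def algebra_simps)

lemma log_deriv_power: "log_deriv f u \<Longrightarrow> log_deriv (f ^ m) (of_nat m * u)"
  by (induction m) (auto simp: log_deriv_def algebra_simps)

lemma log_deriv_dil3: "log_deriv f u \<Longrightarrow> log_deriv (dil3 f) (3 * dil3 u)"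
  by (simp add: log_deriv_def)

lemma log_deriv_X: "log_deriv fps_X 1"
  by (simp add: log_deriv_def qd_def)

lemma log_deriv_inverse:
  assumes "f * g = 1" "log_deriv f u"
  shows "log_deriv g (- u)"
proof -
  have "f * qd g + u * f * g = 0"
    using arg_cong[OF assms(1), of qd] assms(2) by (simp add: log_deriv_def)
  then have "g * (f * qd g + u * f * g) = 0"
    by simp
  then have "(f * g) * qd g + u * (f * g) * g = 0"
    by (simp add: algebra_simps)
  then show ?thesis
    unfolding assms log_deriv_def by (simp add: add_eq_0_iff2)
qed

definition euler_log :: "int fps" where
  "euler_log = qd euler * euler_inv"

lemma log_deriv_euler: "log_deriv euler euler_log"
  using euler_mult_inv by (simp add: log_deriv_def euler_log_def mult_ac)

lemma log_deriv_euler_inv: "log_deriv euler_inv (- euler_log)"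
  by (rule log_deriv_inverse[OF euler_mult_inv log_deriv_euler])

definition cubic_a :: "int fps" where
  "cubic_a = cubic_A * euler_inv"

definition cubic_b :: "int fps" where
  "cubic_b = euler ^ 3 * dil3 euler_inv"

text \<open>In the usual notation \<open>cubic_C\<close> is \<open>c\<^sup>3 / 27\<close> and \<open>cubic_e\<close> is \<open>c(q\<^sup>3) / 3\<close>.\<close>
definition cubic_C :: "int fps" where
  "cubic_C = fps_X * dil3 euler ^ 9 * euler_inv ^ 3"

definition cubic_e :: "int fps" where
  "cubic_e = fps_X * dil3 (dil3 euler) ^ 3 * dil3 euler_inv"

lemma dil3_euler_mult_inv: "dil3 euler * dil3 euler_inv = 1"
  and dil3_dil3_euler_mult_inv: "dil3 (dil3 euler) * dil3 (dil3 euler_inv) = 1"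
  by (simp_all add: euler_mult_inv flip: dil3_mult)

lemma cubic_nth_0 [simp]: "cubic_a $ 0 = 1" "cubic_b $ 0 = 1"
  by (simp_all add: cubic_a_def cubic_b_def cubic_A_def dil3_nth power3_eq_cube)

lemma cubic_nonzero [simp]: "cubic_a \<noteq> 0" "cubic_b \<noteq> 0"
  by (metis cubic_nth_0 fps_zero_nth zero_neq_one)+

lemma cubic_a_cube: "cubic_a ^ 3 = cubic_b ^ 3 + 27 * cubic_C"
proof -
  define x p q i j A :: "int fps"
    where "x = fps_X" "p = euler" "q = dil3 euler" "i = euler_inv" "j = dil3 euler_inv" "A = cubic_A"
  note d = x_p_q_i_j_A_def
  have pi: "p * i = 1" and qj: "q * j = 1"
    using euler_mult_inv dil3_euler_mult_inv by (simp_all add: d)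
  have "A ^ 3 * q ^ 3 = p ^ 12 + 27 * x * q ^ 12"
    using cubic_A_cube by (simp add: d algebra_simps flip: power_add)
  then have "(A * i) ^ 3 * (q * j) ^ 3 =
      (p * i) ^ 3 * (p ^ 3 * j) ^ 3 + 27 * (x * q ^ 9 * i ^ 3) * (q * j) ^ 3"
    by algebra
  then show ?thesis
    unfolding pi qj by (simp add: cubic_a_def cubic_b_def cubic_C_def d)
qed

lemma cubic_e_cube: "cubic_e ^ 3 = dil3 cubic_C"
  by (simp add: cubic_e_def cubic_C_def power_mult_distrib flip: power_mult)

lemma cubic_b_dissection: "cubic_b = dil3 cubic_a - 3 * cubic_e"
  by (simp add: cubic_b_def cubic_a_def cubic_e_def euler_cube_dissection algebra_simps)

text \<open>Both sides are \<open>fps_X * dil3 euler ^ 8\<close>.\<close>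

lemma cubic_C_mult_b: "cubic_C * cubic_b = cubic_e * dil3 cubic_b ^ 3"
proof -
  define x p q r i j k :: "int fps"
    where "x = fps_X" "p = euler" "q = dil3 euler" "r = dil3 (dil3 euler)"
      "i = euler_inv" "j = dil3 euler_inv" "k = dil3 (dil3 euler_inv)"
  note d = x_p_q_r_i_j_k_def
  have "cubic_C * cubic_b = x * q ^ 9 * j * (p * i) ^ 3"
    unfolding cubic_C_def cubic_b_def d by algebra
  moreover have "cubic_e * dil3 cubic_b ^ 3 = x * q ^ 9 * j * (r * k) ^ 3"
    unfolding cubic_e_def cubic_b_def d dil3_mult dil3_power by algebra
  ultimately show ?thesis
    using euler_mult_inv dil3_dil3_euler_mult_inv by (simp only: d power_one)
qed

lemma dil3_cubic_a_cube: "dil3 cubic_a ^ 3 = dil3 cubic_b ^ 3 + 27 * cubic_e ^ 3"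
  using arg_cong[OF cubic_a_cube, of dil3] by (simp add: cubic_e_cube)

text \<open>Here \<open>dil3 cubic_b ^ 3\<close> is a difference of cubes with linear factor
  \<open>cubic_b\<close>, which cancels.\<close>

lemma cubic_C_dissection:
  "cubic_C = cubic_e * (dil3 cubic_a ^ 2 + 3 * dil3 cubic_a * cubic_e + 9 * cubic_e ^ 2)"
proof -
  define a e where "a = dil3 cubic_a" "e = cubic_e"
  have b3: "dil3 cubic_b ^ 3 = a ^ 3 - 27 * e ^ 3"
    using dil3_cubic_a_cube by (simp add: a_e_def)
  have "cubic_b * cubic_C = e * (a ^ 3 - 27 * e ^ 3)"
    using cubic_C_mult_b b3 by (simp add: a_e_def mult_ac)
  also have "\<dots> = (a - 3 * e) * (e * (a ^ 2 + 3 * a * e + 9 * e ^ 2))"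
    by algebra
  also have "a - 3 * e = cubic_b"
    by (simp add: cubic_b_dissection a_e_def)
  finally show ?thesis
    by (simp add: a_e_def)
qed

text \<open>Both sides have the same cube, and the quadratic cofactor of their difference has
  constant term 3, hence is nonzero.\<close>

lemma cubic_a_dissection: "cubic_a = dil3 cubic_a + 6 * cubic_e"
proof -
  define a e where "a = dil3 cubic_a" "e = cubic_e"
  define y where "y = a + 6 * e"
  have "cubic_a ^ 3 = (a - 3 * e) ^ 3 + 27 * (e * (a ^ 2 + 3 * a * e + 9 * e ^ 2))"
    unfolding cubic_a_cube cubic_C_dissection cubic_b_dissection a_e_def ..
  also have "\<dots> = y ^ 3"
    unfolding y_def by algebra
  finally have "(cubic_a - y) * (cubic_a ^ 2 + cubic_a * y + y ^ 2) = 0"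
    by algebra
  moreover have "(cubic_a ^ 2 + cubic_a * y + y ^ 2) $ 0 = 3"
    by (simp add: y_def a_e_def power2_eq_square dil3_nth cubic_e_def)
  then have "cubic_a ^ 2 + cubic_a * y + y ^ 2 \<noteq> 0"
    by (metis fps_zero_nth zero_neq_numeral)
  ultimately show ?thesis
    by (simp add: y_def a_e_def)
qed

section \<open>The differential system\<close>

definition cubic_beta :: "int fps" where
  "cubic_beta = 3 * euler_log - 3 * dil3 euler_log"

lemma qd_b: "qd cubic_b = cubic_beta * cubic_b"
proof -
  have "log_deriv cubic_b (of_nat 3 * euler_log + 3 * dil3 (- euler_log))"
    unfolding cubic_b_def
    by (intro log_deriv_mult log_deriv_power log_deriv_dil3 log_deriv_euler log_deriv_euler_inv)
  then show ?thesis
    by (simp add: log_deriv_def cubic_beta_def)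
qed

text \<open>The term \<open>3 * cubic_beta\<close> is split off because the remaining weight 2
  series turns out to be \<open>cubic_a ^ 2\<close>.\<close>

lemma qd_C_euler_log: "qd cubic_C = (1 + 36 * dil3 euler_log - 12 * euler_log + 3 * cubic_beta) * cubic_C"
proof -
  have "log_deriv cubic_C (1 + of_nat 9 * (3 * dil3 euler_log) + of_nat 3 * (- euler_log))"
    unfolding cubic_C_def
    by (intro log_deriv_mult log_deriv_power log_deriv_dil3 log_deriv_euler log_deriv_euler_inv log_deriv_X)
  then show ?thesis
    by (simp add: log_deriv_def cubic_beta_def algebra_simps)
qed

lemma qd_e_euler_log:
  "qd cubic_e = (dil3 (1 + 36 * dil3 euler_log - 12 * euler_log) + 3 * dil3 cubic_beta) * cubic_e"
proof -
  have "log_deriv cubic_e (1 + of_nat 3 * (3 * dil3 (3 * dil3 euler_log)) + 3 * dil3 (- euler_log))"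
    unfolding cubic_e_def
    by (intro log_deriv_mult log_deriv_power log_deriv_dil3 log_deriv_euler log_deriv_euler_inv log_deriv_X)
  then show ?thesis
    by (simp add: log_deriv_def cubic_beta_def algebra_simps)
qed

lemma dil3_fixed_point:
  assumes "dil3 f = f" "0 < n"
  shows "f $ n = 0"
  using assms(2)
proof (induction n rule: less_induct)
  case (less n)
  have "f $ n = dil3 f $ n"
    by (simp add: assms)
  then show ?case
    using less by (auto simp: dil3_nth elim!: dvdE)
qed

text \<open>Both sides satisfy the same cubic transformation, so their quotient is invariant under
  \<open>q \<mapsto> q\<^sup>3\<close> and hence constant.\<close>
lemma cubic_a_square: "cubic_a ^ 2 = 1 + 36 * dil3 euler_log - 12 * euler_log"
proof -
  define f where "f = 1 + 36 * dil3 euler_log - 12 * euler_log"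
  define a e b s t u g h where "a = dil3 cubic_a" "e = cubic_e" "b = dil3 cubic_b" "s = cubic_beta"
    "t = dil3 cubic_beta" "u = qd (dil3 cubic_a)" "g = dil3 f" "h = cubic_a"
  note d = a_e_b_s_t_u_g_h_def
  have de: "qd e = (g + 3 * t) * e"
    using qd_e_euler_log by (simp add: d f_def)
  have db: "qd b = 3 * t * b"
    using qd_b by (simp add: d)
  have cube: "a ^ 3 = b ^ 3 + 27 * e ^ 3"
    using dil3_cubic_a_cube by (simp add: d)
  have "3 * (a ^ 2 * u) = 3 * (3 * t * b ^ 3 + 27 * e ^ 3 * (g + 3 * t))"
  proof -
    have "3 * a ^ 2 * u = 3 * b ^ 2 * qd b + 27 * (3 * e ^ 2 * qd e)"
      using arg_cong[OF cube, of qd] by (simp add: d)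
    then show ?thesis
      unfolding de db by algebra
  qed
  then have du: "a ^ 2 * u = 3 * t * b ^ 3 + 27 * e ^ 3 * (g + 3 * t)"
    by (subst (asm) mult_left_cancel) simp_all
  \<comment> \<open>Differentiating the dissection of \<open>cubic_b\<close> expresses
    \<open>s\<close> through series in \<open>q\<^sup>3\<close> and \<open>e\<close>.\<close>
  have "s * (a - 3 * e) = u - 3 * ((g + 3 * t) * e)"
    using qd_b de unfolding cubic_b_dissection by (simp add: d)
  then have "a ^ 2 * (s * (a - 3 * e)) = a ^ 2 * u - 3 * a ^ 2 * ((g + 3 * t) * e)"
    by algebra
  also have "\<dots> = (a - 3 * e) * (3 * t * a ^ 2 - 3 * e * g * (a + 3 * e))"
    unfolding du using cube by algebra
  finally have "(a - 3 * e) * (a ^ 2 * s) = (a - 3 * e) * (3 * t * a ^ 2 - 3 * e * g * (a + 3 * e))"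
    by (simp only: mult_ac)
  moreover have "a - 3 * e \<noteq> 0"
    using cubic_nonzero(2) unfolding cubic_b_dissection d .
  ultimately have s: "a ^ 2 * s = 3 * t * a ^ 2 - 3 * e * g * (a + 3 * e)"
    by simp
  have f: "f = g + 12 * t - 4 * s"
    by (simp add: d f_def cubic_beta_def algebra_simps)
  have h: "h = a + 6 * e"
    using cubic_a_dissection by (simp add: d)
  \<comment> \<open>This says that \<open>f / h ^ 2\<close> equals its own image under
    \<open>dil3\<close>; that quotient is \<open>R\<close> below.\<close>
  have fg: "a ^ 2 * f = g * h ^ 2"
    unfolding h f using s by algebra
  define w where "w = fps_right_inverse h 1"
  have hw: "h * w = 1"
    unfolding w_def by (rule fps_right_inverse) (simp add: d)
  then have aw: "a * dil3 w = 1"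
    by (simp add: d flip: dil3_mult)
  define R where "R = f * w ^ 2"
  have "dil3 R = g * dil3 w ^ 2 * (h * w) ^ 2"
    using hw by (simp add: R_def d)
  also have "\<dots> = (g * h ^ 2) * (dil3 w ^ 2 * w ^ 2)"
    by algebra
  also have "\<dots> = (a * dil3 w) ^ 2 * R"
    unfolding fg[symmetric] R_def by algebra
  finally have "dil3 R = R"
    using aw by simp
  then have "R $ n = 0" if "0 < n" for n
    using that dil3_fixed_point by blast
  moreover have "R $ 0 = 1"
    by (simp add: R_def f_def w_def power2_eq_square euler_log_def qd_nth dil3_nth d)
  ultimately have "R = 1"
    by (auto simp: fps_eq_iff)
  then have "h ^ 2 = f * (h * w) ^ 2"
    by (simp add: R_def power_mult_distrib mult_ac)
  then show ?thesis
    using hw by (simp add: f_def d)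
qed

lemma qd_C: "qd cubic_C = (cubic_a ^ 2 + 3 * cubic_beta) * cubic_C"
  unfolding cubic_a_square by (rule qd_C_euler_log)

lemma qd_e: "qd cubic_e = (dil3 cubic_a ^ 2 + 3 * dil3 cubic_beta) * cubic_e"
  using qd_e_euler_log unfolding cubic_a_square[symmetric] by simp

text \<open>Differentiate \<open>cubic_a_cube\<close> and cancel
  \<open>3 * cubic_a ^ 2\<close>.\<close>

lemma qd_a: "qd cubic_a = cubic_a * cubic_beta + 9 * cubic_C"
proof -
  define a b c s where "a = cubic_a" "b = cubic_b" "c = cubic_C" "s = cubic_beta"
  note d = a_b_c_s_def
  have cube: "a ^ 3 = b ^ 3 + 27 * c" and db: "qd b = s * b" and dc: "qd c = (a ^ 2 + 3 * s) * c"
    using cubic_a_cube qd_b qd_C by (simp_all add: d)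
  have "3 * a ^ 2 * qd a = 3 * b ^ 2 * qd b + 27 * qd c"
    using arg_cong[OF cube, of qd] by simp
  then have "(3 * a ^ 2) * qd a = (3 * a ^ 2) * (a * s + 9 * c)"
    unfolding db dc using cube by algebra
  then show ?thesis
    by (simp add: d)
qed

text \<open>The cubic transformations turn the error term \<open>D\<close> into
  \<open>9 * dil3 D\<close>. This kills the constant coefficient, and the others follow by descent
  from \<open>n\<close> to \<open>n div 3\<close>.\<close>

lemma qd_beta: "qd cubic_beta = cubic_beta ^ 2 - 3 * cubic_a * cubic_C"
proof -
  define D where "D = qd cubic_beta - cubic_beta ^ 2 + 3 * cubic_a * cubic_C"
  define a e t v where "a = dil3 cubic_a" "e = cubic_e" "t = dil3 cubic_beta" "v = dil3 D"
  note d = a_e_t_v_def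
  have da: "qd a = 3 * (a * t + 9 * e ^ 3)"
    by (simp add: d qd_a cubic_e_cube)
  have de: "qd e = (a ^ 2 + 3 * t) * e"
    by (simp add: d qd_e)
  have b: "a - 3 * e = cubic_b"
    by (simp add: d cubic_b_dissection)
  have "(a - 3 * e) * cubic_beta = qd (a - 3 * e)"
    unfolding b qd_b by simp
  also have "\<dots> = 3 * (a * t + 9 * e ^ 3) - 3 * ((a ^ 2 + 3 * t) * e)"
    by (simp add: da de)
  also have "\<dots> = (a - 3 * e) * (3 * t - 3 * e * (a + 3 * e))"
    by algebra
  finally have s: "cubic_beta = 3 * t - 3 * e * (a + 3 * e)"
    unfolding b by simp
  have dt: "qd t = 3 * (v + t ^ 2 - 3 * a * e ^ 3)"
    by (simp add: d D_def cubic_e_cube)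
  have "D = 3 * qd t - (3 * qd e * (a + 3 * e) + 3 * e * (qd a + 3 * qd e)) - (3 * t - 3 * e * (a + 3 * e)) ^ 2
      + 3 * (a + 6 * e) * (e * (a ^ 2 + 3 * a * e + 9 * e ^ 2))"
  proof -
    have "qd cubic_beta = 3 * qd t - (3 * qd e * (a + 3 * e) + 3 * e * (qd a + 3 * qd e))"
      unfolding s by (simp add: algebra_simps)
    moreover have "cubic_C = e * (a ^ 2 + 3 * a * e + 9 * e ^ 2)" "cubic_a = a + 6 * e"
      using cubic_C_dissection cubic_a_dissection by (simp_all add: d)
    ultimately show ?thesis
      unfolding D_def using s by simp
  qed
  also have "\<dots> = 9 * v"
    unfolding da de dt by algebra
  finally have D: "D = 9 * dil3 D"
    by (simp add: d)
  have "D $ n = 0" for n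
  proof (induction n rule: less_induct)
    case (less n)
    have *: "D $ n = 9 * dil3 D $ n"
      by (subst D) (simp add: numeral_fps_const)
    show ?case
    proof (cases "n = 0")
      case True
      with * show ?thesis
        by (simp add: dil3_nth)
    next
      case False
      with * less show ?thesis
        by (auto simp: dil3_nth elim!: dvdE)
    qed
  qed
  then have "D = 0"
    by (simp add: fps_eq_iff)
  then show ?thesis
    by (simp add: D_def algebra_simps)
qed

section \<open>The generating function and its dissection\<close>

definition rat_fps :: "int fps \<Rightarrow> rat fps" where
  "rat_fps f = Abs_fps (\<lambda>n. of_int (f $ n))"

lemma rat_fps_mult: "rat_fps (f * g) = rat_fps f * rat_fps g"
  by (simp add: rat_fps_def fps_eq_iff fps_mult_nth)

lemma rat_fps_1: "rat_fps 1 = 1"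
  by (simp add: rat_fps_def fps_eq_iff)

lemma rat_fps_power: "rat_fps (f ^ k) = rat_fps f ^ k"
  by (induction k) (simp_all add: rat_fps_mult rat_fps_1)

lemma rat_fps_factor: "rat_fps (1 - fps_X ^ k) = 1 - fps_X ^ k"
  by (auto simp: rat_fps_def fps_eq_iff)

lemma rat_fps_euler_part:
  "rat_fps (euler_part (Suc n) ^ 3 * dil3 (euler_part (Suc n))) =
    (\<Prod>k\<le>n. (1 - fps_X ^ (3 * (k + 1))) * (1 - fps_X ^ (k + 1)) ^ 3)"
proof -
  have e: "rat_fps (euler_part (Suc n)) = (\<Prod>k\<le>n. 1 - fps_X ^ (k + 1))"
    by (induction n) (simp_all add: euler_part_Suc[of "Suc _"] euler_part_Suc[of 0] rat_fps_mult rat_fps_factor rat_fps_factor[of 1, simplified]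
      del: power_Suc)
  have t: "rat_fps (dil3 (euler_part (Suc n))) = (\<Prod>k\<le>n. 1 - fps_X ^ (3 * (k + 1)))"
    by (induction n) (simp_all add: euler_part_Suc[of "Suc _"] euler_part_Suc[of 0] rat_fps_mult rat_fps_factor
      del: power_Suc flip: power_mult)
  show ?thesis
    unfolding rat_fps_mult rat_fps_power e t prod.distrib prod_power_distrib[symmetric] by (rule mult.commute)
qed

text \<open>Convergence means that each coefficient is eventually constant. For each
  \<open>j\<close>, one late partial product therefore has the limit's coefficients up to
  \<open>j\<close>, and its finite inverse agrees with that of the limit there.\<close>

lemma gen_fun_eq_euler_inv:
  fixes a :: "nat \<Rightarrow> int"
  assumes "(\<lambda>k. 1 / ((1 - fps_X ^ (3 * (k + 1))) * (1 - fps_X ^ (k + 1)) ^ 3))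
             has_prod (Abs_fps (\<lambda>m. of_int (a m)) :: rat fps)"
  shows "Abs_fps a = euler_inv ^ 3 * dil3 euler_inv"
proof -
  define d :: "nat \<Rightarrow> rat fps"
    where "d k = (1 - fps_X ^ (3 * (k + 1))) * (1 - fps_X ^ (k + 1)) ^ 3" for k
  define P where "P n = (\<Prod>k\<le>n. 1 / d k)" for n
  define g where "g = Abs_fps a"
  define e where "e = euler ^ 3 * dil3 euler"
  have d0: "d k $ 0 = 1" for k
    by (simp add: d_def power3_eq_cube)
  have "1 / d k * d k = 1" for k
    using d0[of k] by (simp add: fps_divide_unit inverse_mult_eq_1)
  then have Pd: "P n * (\<Prod>k\<le>n. d k) = 1" for n
    unfolding P_def prod.distrib[symmetric] by simp
  have lim: "P \<longlonglongrightarrow> rat_fps g"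
    using has_prod_imp_tendsto[OF assms] unfolding P_def[abs_def] d_def g_def rat_fps_def fps_nth_Abs_fps .
  have "rat_fps (g * e) $ j = rat_fps 1 $ j" for j
  proof -
    have "\<forall>\<^sub>F n in sequentially. \<forall>i\<in>{0..j}. P n $ i = rat_fps g $ i"
      using lim by (intro eventually_ball_finite) (auto simp: tendsto_fps_iff)
    then have "\<forall>\<^sub>F n in sequentially. j \<le> n \<and> (\<forall>i\<in>{0..j}. P n $ i = rat_fps g $ i)"
      using eventually_ge_at_top[of j] by eventually_elim auto
    then obtain n where n: "j \<le> n" "\<forall>i\<in>{0..j}. P n $ i = rat_fps g $ i"
      using eventually_happens' sequentially_bot by blast
    have "eq_upto (Suc j) e (euler_part (Suc n) ^ 3 * dil3 (euler_part (Suc n)))"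
      unfolding e_def using n(1) by (intro eq_upto_mult eq_upto_power eq_upto_dil3 euler_eq_upto) auto
    then have e: "rat_fps e $ i = (\<Prod>k\<le>n. d k) $ i" if "i \<le> j" for i
      using that unfolding d_def rat_fps_euler_part[symmetric] by (simp add: eq_upto_def rat_fps_def)
    have "rat_fps (g * e) $ j = (\<Sum>i=0..j. rat_fps g $ i * rat_fps e $ (j - i))"
      unfolding rat_fps_mult fps_mult_nth ..
    also have "\<dots> = (\<Sum>i=0..j. P n $ i * (\<Prod>k\<le>n. d k) $ (j - i))"
      using n(2) e by (intro sum.cong) auto
    also have "\<dots> = (P n * (\<Prod>k\<le>n. d k)) $ j"
      unfolding fps_mult_nth ..
    finally show ?thesis
      unfolding Pd rat_fps_1 .
  qed
  then have "g * e = 1"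
    by (simp add: fps_eq_iff rat_fps_def)
  then have "g * (e * (euler_inv ^ 3 * dil3 euler_inv)) = euler_inv ^ 3 * dil3 euler_inv"
    by (simp flip: mult.assoc)
  moreover have "e * (euler_inv ^ 3 * dil3 euler_inv) = (euler * euler_inv) ^ 3 * (dil3 euler * dil3 euler_inv)"
    by (simp only: e_def power_mult_distrib mult_ac)
  ultimately show ?thesis
    by (simp add: euler_mult_inv dil3_euler_mult_inv g_def)
qed

text \<open>All exponents in \<open>cubic_e\<close> are 1 modulo 3, so only the middle summand
  reaches the index \<open>3 * n + 1\<close>.\<close>

lemma cubic_dissection_nth:
  assumes "f = dil3 h + cubic_e * dil3 g + cubic_e ^ 2 * dil3 k"
  shows "f $ (3 * n + 1) = (dil3 euler ^ 3 * euler_inv * g) $ n"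
proof -
  define w where "w = dil3 euler ^ 3 * euler_inv"
  have e: "cubic_e = fps_X * dil3 w"
    by (simp add: cubic_e_def w_def mult_ac)
  have "f = dil3 h + fps_X * dil3 (w * g) + fps_X ^ 2 * dil3 (w ^ 2 * k)"
    unfolding assms e by (simp add: power_mult_distrib mult_ac)
  moreover have "(fps_X ^ 2 * dil3 f) $ (3 * n + 1) = 0" for f
  proof -
    \<comment> \<open>The second alternative covers \<open>n = 0\<close>, where the subtraction
      truncates to 0.\<close>
    have "\<not> 3 dvd 3 * n + 1 - 2 \<or> 3 * n + 1 < 2"
      by presburger
    then show ?thesis
      by (auto simp: fps_X_power_mult_nth dil3_nth)
  qed
  moreover have "dil3 h $ (3 * n + 1) = 0"
  proof -
    have "\<not> 3 dvd 3 * n + 1"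
      by presburger
    then show ?thesis
      by (simp add: dil3_nth)
  qed
  ultimately show ?thesis
    by (simp add: dil3_nth w_def del: dil3_mult)
qed

text \<open>Used to rewrite \<open>1 / cubic_b\<close> as a quadratic in \<open>cubic_e\<close> over
  a series in \<open>q\<^sup>3\<close>.\<close>

lemma dil3_cubic_b_factor:
  "dil3 cubic_b ^ 3 = cubic_b * (dil3 cubic_a ^ 2 + 3 * dil3 cubic_a * cubic_e + 9 * cubic_e ^ 2)"
  using dil3_cubic_a_cube unfolding cubic_b_dissection by algebra

definition cubic_Z :: "int fps" where
  "cubic_Z = dil3 euler ^ 15 * euler_inv ^ 35"

text \<open>The coefficients are those of the part linear in \<open>e\<close> in
  \<open>gen_fun_nth_9\<close>, divided by 9.\<close>

definition cubic_Y :: "int fps" where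
  "cubic_Y = 2 * cubic_a ^ 8 + 459 * cubic_a ^ 5 * cubic_C + 5832 * cubic_a ^ 2 * cubic_C ^ 2"

text \<open>The series is \<open>dil3 euler_inv ^ 2 / cubic_b\<close>, so one use of
  \<open>dil3_cubic_b_factor\<close> dissects it.\<close>

lemma gen_fun_nth_3:
  "(euler_inv ^ 3 * dil3 euler_inv) $ (3 * n + 1) = 3 * (cubic_a * dil3 euler ^ 6 * euler_inv ^ 12) $ n"
proof -
  define p q r i j k :: "int fps"
    where "p = euler" "q = dil3 euler" "r = dil3 (dil3 euler)"
      "i = euler_inv" "j = dil3 euler_inv" "k = dil3 (dil3 euler_inv)"
  note d = p_q_r_i_j_k_def
  define m where "m = dil3 cubic_a ^ 2 + 3 * dil3 cubic_a * cubic_e + 9 * cubic_e ^ 2"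
  have inv: "p * i = 1" "q * j = 1" "r * k = 1"
    using euler_mult_inv dil3_euler_mult_inv dil3_dil3_euler_mult_inv by (simp_all add: d)
  have b: "cubic_b = p ^ 3 * j" "dil3 cubic_b = q ^ 3 * k"
    by (simp_all add: cubic_b_def d)
  have "cubic_b * (i ^ 3 * j) = j ^ 2 * (p * i) ^ 3"
    unfolding b by algebra
  also have "\<dots> = j ^ 11 * r ^ 3 * dil3 cubic_b ^ 3"
  proof -
    have "j ^ 11 * r ^ 3 * dil3 cubic_b ^ 3 = j ^ 2 * (q * j) ^ 9 * (r * k) ^ 3"
      unfolding b(2) by algebra
    then show ?thesis
      unfolding inv by simp
  qed
  also have "\<dots> = cubic_b * (j ^ 11 * r ^ 3 * m)"
    unfolding dil3_cubic_b_factor m_def by (simp only: mult_ac)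
  finally have "i ^ 3 * j = j ^ 11 * r ^ 3 * m"
    by simp
  then have "i ^ 3 * j = dil3 (i ^ 11 * q ^ 3 * cubic_a ^ 2) + cubic_e * dil3 (3 * i ^ 11 * q ^ 3 * cubic_a)
      + cubic_e ^ 2 * dil3 (9 * i ^ 11 * q ^ 3)"
    by (simp add: d m_def algebra_simps)
  from cubic_dissection_nth[OF this]
  have "(i ^ 3 * j) $ (3 * n + 1) = (q ^ 3 * i * (3 * i ^ 11 * q ^ 3 * cubic_a)) $ n"
    by (simp only: d)
  also have "q ^ 3 * i * (3 * i ^ 11 * q ^ 3 * cubic_a) = 3 * (cubic_a * q ^ 6 * i ^ 12)"
    by algebra
  finally show ?thesis
    by (simp add: d numeral_fps_const)
qed

text \<open>Now the series is \<open>cubic_a * dil3 euler ^ 2 / cubic_b ^ 4\<close>, dissected with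
  the fourth power of the same factor.\<close>

lemma gen_fun_nth_9:
  "(cubic_a * dil3 euler ^ 6 * euler_inv ^ 12) $ (3 * n + 1) = 9 * (cubic_Y * cubic_Z) $ n"
proof -
  define p q r i j k :: "int fps"
    where "p = euler" "q = dil3 euler" "r = dil3 (dil3 euler)"
      "i = euler_inv" "j = dil3 euler_inv" "k = dil3 (dil3 euler_inv)"
  note d = p_q_r_i_j_k_def
  define a e where "a = dil3 cubic_a" "e = cubic_e"
  have inv: "p * i = 1" "q * j = 1" "r * k = 1"
    using euler_mult_inv dil3_euler_mult_inv dil3_dil3_euler_mult_inv by (simp_all add: d)
  have b: "cubic_b = p ^ 3 * j" "dil3 cubic_b = q ^ 3 * k"
    by (simp_all add: cubic_b_def d)
  have "cubic_b ^ 4 * (q ^ 6 * i ^ 12) = q ^ 2 * (q * j) ^ 4 * (p * i) ^ 12"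
    unfolding b by algebra
  also have "\<dots> = j ^ 34 * r ^ 12 * (dil3 cubic_b ^ 3) ^ 4"
  proof -
    have "j ^ 34 * r ^ 12 * (dil3 cubic_b ^ 3) ^ 4 = q ^ 2 * (q * j) ^ 34 * (r * k) ^ 12"
      unfolding b(2) by algebra
    then show ?thesis
      unfolding inv by simp
  qed
  also have "\<dots> = cubic_b ^ 4 * (j ^ 34 * r ^ 12 * (a ^ 2 + 3 * a * e + 9 * e ^ 2) ^ 4)"
    unfolding dil3_cubic_b_factor a_e_def power_mult_distrib by (simp only: mult_ac)
  finally have "q ^ 6 * i ^ 12 = j ^ 34 * r ^ 12 * (a ^ 2 + 3 * a * e + 9 * e ^ 2) ^ 4"
    by simp
  then have "cubic_a * q ^ 6 * i ^ 12 = j ^ 34 * r ^ 12 * ((a + 6 * e) * (a ^ 2 + 3 * a * e + 9 * e ^ 2) ^ 4)"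
    using cubic_a_dissection unfolding a_e_def[symmetric] by (simp only: mult_ac)
  \<comment> \<open>Grouped by the exponent of \<open>e\<close> modulo 3, since \<open>e ^ 3\<close>
    is a series in \<open>q\<^sup>3\<close>.\<close>
  also have "(a + 6 * e) * (a ^ 2 + 3 * a * e + 9 * e ^ 2) ^ 4 =
      (a ^ 9 + 972 * a ^ 6 * e ^ 3 + 30618 * a ^ 3 * (e ^ 3) ^ 2 + 39366 * (e ^ 3) ^ 3)
      + e * (18 * a ^ 8 + 4131 * a ^ 5 * e ^ 3 + 52488 * a ^ 2 * (e ^ 3) ^ 2)
      + e ^ 2 * (162 * a ^ 7 + 13122 * a ^ 4 * e ^ 3 + 59049 * a * (e ^ 3) ^ 2)"
    by algebra
  also have "j ^ 34 * r ^ 12 * \<dots> =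
     dil3 (i ^ 34 * q ^ 12 * (cubic_a ^ 9 + 972 * cubic_a ^ 6 * cubic_C + 30618 * cubic_a ^ 3 * cubic_C ^ 2 + 39366 * cubic_C ^ 3))
     + e * dil3 (i ^ 34 * q ^ 12 * (18 * cubic_a ^ 8 + 4131 * cubic_a ^ 5 * cubic_C + 52488 * cubic_a ^ 2 * cubic_C ^ 2))
     + e ^ 2 * dil3 (i ^ 34 * q ^ 12 * (162 * cubic_a ^ 7 + 13122 * cubic_a ^ 4 * cubic_C + 59049 * cubic_a * cubic_C ^ 2))"
    unfolding a_e_def cubic_e_cube by (simp add: d distrib_left mult_ac)
  finally have "(cubic_a * q ^ 6 * i ^ 12) $ (3 * n + 1) =
      (q ^ 3 * i * (i ^ 34 * q ^ 12 * (18 * cubic_a ^ 8 + 4131 * cubic_a ^ 5 * cubic_C + 52488 * cubic_a ^ 2 * cubic_C ^ 2))) $ n"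
    unfolding a_e_def(2) using cubic_dissection_nth by (simp only: d)
  also have "q ^ 3 * i * (i ^ 34 * q ^ 12 * (18 * cubic_a ^ 8 + 4131 * cubic_a ^ 5 * cubic_C + 52488 * cubic_a ^ 2 * cubic_C ^ 2))
      = 9 * (cubic_Y * cubic_Z)"
    unfolding cubic_Y_def cubic_Z_def d by algebra
  finally show ?thesis
    by (simp add: d numeral_fps_const)
qed

section \<open>Divisibility by 5\<close>

lemma numeral_dvd_fps_iff: "numeral k dvd f \<longleftrightarrow> (\<forall>n. numeral k dvd f $ n)" for f :: "int fps"
proof
  assume "numeral k dvd f"
  then show "\<forall>n. numeral k dvd f $ n"
    by (auto simp: numeral_fps_const elim!: dvdE)
next
  assume *: "\<forall>n. numeral k dvd f $ n"
  have "f = numeral k * Abs_fps (\<lambda>n. f $ n div numeral k)"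
    using * by (simp add: fps_eq_iff numeral_fps_const)
  then show "numeral k dvd f"
    by (rule dvdI)
qed

lemma dvd_unit_cancel:
  fixes f g k :: "int fps"
  assumes "k dvd f * g" "f $ 0 = 1"
  shows "k dvd g"
proof -
  have "f * fps_right_inverse f 1 = 1"
    using assms(2) by (intro fps_right_inverse) simp
  then have "g = (f * g) * fps_right_inverse f 1"
    by (simp add: mult_ac)
  then show ?thesis
    using assms(1) by (metis dvd_mult2)
qed

text \<open>Fermat's little theorem applied to the index of each coefficient.\<close>

lemma qd_5_cong: "5 dvd qd (qd (qd (qd (qd f)))) - qd f"
proof -
  have five: "(5 :: int) dvd x * (x * (x * (x * x))) - x" for x
  proof -
    have "x mod 5 = 0 \<or> x mod 5 = 1 \<or> x mod 5 = 2 \<or> x mod 5 = 3 \<or> x mod 5 = 4"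
      by presburger
    then have "(x ^ 5 - x) mod 5 = 0"
      by (elim disjE) (simp_all add: mod_diff_eq[symmetric, of "x ^ 5"] power_mod[symmetric, of x])
    then show ?thesis
      by (simp add: eval_nat_numeral dvd_eq_mod_eq_0)
  qed
  have "5 dvd int n * (int n * (int n * (int n * (int n * y)))) - int n * y" for n y
  proof -
    have "int n * (int n * (int n * (int n * (int n * y)))) - int n * y =
        (int n * (int n * (int n * (int n * int n))) - int n) * y"
      by (simp add: algebra_simps)
    then show ?thesis
      using five[of "int n"] by simp
  qed
  then show ?thesis
    by (simp add: numeral_dvd_fps_iff qd_nth)
qed

text \<open>This is the Eisenstein series of weight 4 up to a multiple of 5.\<close>
definition hasse :: "int fps" where
  "hasse = cubic_a ^ 4 + cubic_a * cubic_C"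

text \<open>The Hasse invariant of level 3: for \<open>z = c\<^sup>3 / b\<^sup>3\<close> one has \<open>D z = a\<^sup>2 z\<close>, and computing
  \<open>D\<^sup>5 z\<close> modulo 5 gives \<open>a\<^sup>2 H\<^sup>2 z\<close>, which has to agree with \<open>D z\<close>.\<close>
lemma hasse_square_cong: "5 dvd hasse ^ 2 - 1"
proof -
  define a s c where "a = cubic_a" "s = cubic_beta" "c = cubic_C"
  have da: "qd a = a * s + 9 * c" and ds: "qd s = s ^ 2 - 3 * a * c" and dc: "qd c = (a ^ 2 + 3 * s) * c"
    by (simp_all add: a_s_c_def qd_a qd_beta qd_C)
  \<comment> \<open>This is \<open>cubic_C / cubic_b ^ 3\<close>. The weights from
    \<open>cubic_beta\<close> cancel, leaving the logarithmic derivative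
    \<open>a ^ 2\<close>.\<close>
  define z where "z = cubic_C * (euler_inv ^ 3 * dil3 euler) ^ 3"
  have "log_deriv z ((cubic_a ^ 2 + 3 * cubic_beta) + of_nat 3 * (of_nat 3 * (- euler_log) + 3 * dil3 euler_log))"
    unfolding z_def
    by (intro log_deriv_mult log_deriv_power log_deriv_dil3 log_deriv_euler log_deriv_euler_inv)
      (simp add: log_deriv_def qd_C)
  then have dz: "qd z = a ^ 2 * z"
    by (simp add: log_deriv_def cubic_beta_def a_s_c_def algebra_simps)
  define y1 where "y1 = 2 * a ^ 2 * s + 18 * a * c + a ^ 4"
  define y2 where "y2 = 6 * a ^ 2 * s ^ 2 + 108 * a * s * c + 66 * a ^ 3 * c + 162 * c ^ 2 + 6 * a ^ 4 * s + a ^ 6"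
  define y3 where "y3 = 24 * a ^ 2 * s ^ 3 + 648 * a * s ^ 2 * c + 792 * a ^ 3 * s * c + 1944 * s * c ^ 2
    + 1944 * a ^ 2 * c ^ 2 + 168 * a ^ 5 * c + 36 * a ^ 4 * s ^ 2 + 12 * a ^ 6 * s + a ^ 8"
  \<comment> \<open>What is left of the fifth derivative over \<open>z\<close> after removing
    \<open>a ^ 2 * hasse ^ 2\<close>, divided by 5.\<close>
  define w where "w = 24 * a ^ 2 * s ^ 4 + 864 * a * s ^ 3 * c + 1584 * a ^ 3 * s ^ 2 * c + 3888 * s ^ 2 * c ^ 2
    + 7776 * a ^ 2 * s * c ^ 2 + 2203 * a ^ 4 * c ^ 2 + 672 * a ^ 5 * s * c + 5832 * a * c ^ 3 + 74 * a ^ 7 * c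
    + 48 * a ^ 4 * s ^ 3 + 24 * a ^ 6 * s ^ 2 + 4 * a ^ 8 * s"
  have z2: "qd (qd z) = y1 * z"
    unfolding dz qd_mult qd_power da dz y1_def by simp algebra
  have z3: "qd (qd (qd z)) = y2 * z"
    unfolding z2 by (simp add: y1_def y2_def da ds dc dz) algebra
  have z4: "qd (qd (qd (qd z))) = y3 * z"
    unfolding z3 by (simp add: y2_def y3_def da ds dc dz) algebra
  have z5: "qd (qd (qd (qd (qd z)))) = (a ^ 2 * hasse ^ 2 + 5 * w) * z"
    unfolding z4 by (simp add: y3_def w_def hasse_def a_s_c_def[symmetric] da ds dc dz) algebra
  have "5 dvd (a ^ 2 * hasse ^ 2 + 5 * w) * z - a ^ 2 * z"
    by (subst z5[symmetric], subst dz[symmetric]) (rule qd_5_cong)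
  also have "(a ^ 2 * hasse ^ 2 + 5 * w) * z - a ^ 2 * z = 5 * (w * z) + a ^ 2 * (hasse ^ 2 - 1) * z"
    by algebra
  finally have *: "5 dvd a ^ 2 * (hasse ^ 2 - 1) * z"
    using dvd_add_right_iff[OF dvd_triv_left] by metis
  define u where "u = dil3 euler ^ 12 * euler_inv ^ 12"
  have z: "z = fps_X * u"
    unfolding z_def u_def cubic_C_def by algebra
  have u0: "u $ 0 = 1"
    by (simp add: u_def dil3_nth fps_power_zeroth)
  have "5 dvd u * (fps_X * (a ^ 2 * (hasse ^ 2 - 1)))"
    using * by (simp add: z mult_ac)
  then have "5 dvd fps_X * (a ^ 2 * (hasse ^ 2 - 1))"
    using u0 by (rule dvd_unit_cancel)
  then have "5 dvd (fps_X * (a ^ 2 * (hasse ^ 2 - 1))) $ Suc n" for n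
    unfolding numeral_dvd_fps_iff by blast
  then have "5 dvd a ^ 2 * (hasse ^ 2 - 1)"
    by (simp add: numeral_dvd_fps_iff)
  then show ?thesis
    by (rule dvd_unit_cancel) (simp add: a_s_c_def power2_eq_square)
qed

lemma dvd_qd: "numeral k dvd f \<Longrightarrow> numeral k dvd qd f"
  by (simp add: numeral_dvd_fps_iff qd_nth)

text \<open>Differentiate \<open>hasse_square_cong\<close>; both \<open>hasse\<close> and 2 are
  units modulo 5.\<close>

lemma qd_hasse_cong: "5 dvd qd hasse"
proof -
  have "5 dvd qd (hasse ^ 2 - 1)"
    by (intro dvd_qd hasse_square_cong)
  then have "5 dvd hasse * (2 * qd hasse)"
    by (simp add: mult_ac)
  then have "5 dvd 2 * qd hasse"
    by (rule dvd_unit_cancel) (simp add: hasse_def cubic_C_def eval_nat_numeral)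
  then have "5 dvd 3 * (2 * qd hasse) - 5 * qd hasse"
    by (rule dvd_diff[OF dvd_mult dvd_triv_left])
  then show ?thesis
    by simp
qed

section \<open>The third derivative and the factor 625\<close>

lemma qd_Z: "qd cubic_Z = (45 * dil3 euler_log - 35 * euler_log) * cubic_Z"
proof -
  have "log_deriv cubic_Z (of_nat 15 * (3 * dil3 euler_log) + of_nat 35 * (- euler_log))"
    unfolding cubic_Z_def
    by (intro log_deriv_mult log_deriv_power log_deriv_dil3 log_deriv_euler log_deriv_euler_inv)
  then show ?thesis
    by (simp add: log_deriv_def)
qed

text \<open>Up to the factor 12, \<open>T f\<close> is the derivative of \<open>q\<^sup>5\<^sup>/\<^sup>1\<^sup>2 f\<close>. Since \<open>q\<^sup>5\<^sup>/\<^sup>1\<^sup>2 Y Z\<close> is a modular form of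
  weight \<open>-2\<close>, its third derivative is modular by Bol's identity, and so \<open>\<beta>\<close> drops out.\<close>
lemma triple_derivative:
  defines "T \<equiv> \<lambda>f. 12 * qd f + 5 * f"
  shows "T (T (T (cubic_Y * cubic_Z))) = 125 * (2 * (cubic_a ^ 10 * hasse * cubic_Z)
    + 5 * ((4865 * cubic_a ^ 11 * cubic_C + 1198476 * cubic_a ^ 8 * cubic_C ^ 2
      + 36531648 * cubic_a ^ 5 * cubic_C ^ 3 + 136048896 * cubic_a ^ 2 * cubic_C ^ 4) * cubic_Z))"
proof -
  define a s c where "a = cubic_a" "s = cubic_beta" "c = cubic_C"
  have da: "qd a = a * s + 9 * c" and ds: "qd s = s ^ 2 - 3 * a * c" and dc: "qd c = (a ^ 2 + 3 * s) * c"
    by (simp_all add: a_s_c_def qd_a qd_beta qd_C)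
  have "12 * qd cubic_Z + 5 * cubic_Z = 5 * (a ^ 2 - 24 * s) * cubic_Z"
    unfolding qd_Z a_s_c_def cubic_a_square cubic_beta_def by (simp add: algebra_simps)
  then have step: "T (F * cubic_Z) = (12 * qd F + 5 * (a ^ 2 - 24 * s) * F) * cubic_Z" for F
    unfolding T_def qd_mult by algebra
  \<comment> \<open>By \<open>step\<close>, applying \<open>T\<close> to a multiple of
    \<open>cubic_Z\<close> only changes the cofactor; \<open>F1\<close>, \<open>F2\<close>,
    \<open>F3\<close> are the successive cofactors starting from \<open>cubic_Y\<close>.\<close>
  define F1 where "F1 = 10 * a ^ 10 - 48 * a ^ 8 * s + 9531 * a ^ 7 * c - 11016 * a ^ 5 * s * c
    + 416988 * a ^ 4 * c ^ 2 - 139968 * a ^ 2 * s * c ^ 2 + 1259712 * a * c ^ 3"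
  define F2 where "F2 = 576 * a ^ 8 * s ^ 2 - 228744 * a ^ 7 * s * c + 174555 * a ^ 9 * c + 19694664 * a ^ 6 * c ^ 2
    + 132192 * a ^ 5 * s ^ 2 * c - 10007712 * a ^ 4 * s * c ^ 2 + 236825856 * a ^ 3 * c ^ 3
    + 1679616 * a ^ 2 * s ^ 2 * c ^ 2 - 30233088 * a * s * c ^ 3 + 136048896 * c ^ 4 - 240 * a ^ 10 * s + 50 * a ^ 12"
  \<comment> \<open>Here \<open>s\<close> has disappeared and 125 divides every coefficient. As
    \<open>3040875 = 125 * (2 + 5 * 4865)\<close>, the 2 completes
    \<open>2 * a ^ 10 * hasse\<close>.\<close>
  define F3 where "F3 = 250 * a ^ 14 + 3040875 * a ^ 11 * c + 749047500 * a ^ 8 * c ^ 2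
    + 22832280000 * a ^ 5 * c ^ 3 + 85030560000 * a ^ 2 * c ^ 4"
  have 1: "12 * qd cubic_Y + 5 * (a ^ 2 - 24 * s) * cubic_Y = F1"
    by (simp add: cubic_Y_def F1_def a_s_c_def[symmetric] da dc) algebra
  have 2: "12 * qd F1 + 5 * (a ^ 2 - 24 * s) * F1 = F2"
    by (simp add: F1_def F2_def da ds dc) algebra
  have 3: "12 * qd F2 + 5 * (a ^ 2 - 24 * s) * F2 = F3"
    by (simp add: F2_def F3_def da ds dc) algebra
  have "T (T (T (cubic_Y * cubic_Z))) = F3 * cubic_Z"
    unfolding step 1 2 3 ..
  then show ?thesis
    unfolding F3_def hasse_def a_s_c_def by algebra
qed

lemma numeral_mult_nth: "(numeral k * f) $ n = numeral k * f $ n" for f :: "int fps"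
  by (simp add: numeral_fps_const)

lemma derivative_nth: "(12 * qd f + 5 * f) $ n = (12 * int n + 5) * f $ n"
  by (simp only: fps_add_nth numeral_mult_nth qd_nth) (simp add: algebra_simps)

lemma YZ_coeff_cong:
  assumes "\<not> 5 dvd m"
  shows "625 dvd (cubic_Y * cubic_Z) $ m"
proof -
  define G where "G = cubic_a ^ 10 * hasse * cubic_Z"
  define R where "R = (4865 * cubic_a ^ 11 * cubic_C + 1198476 * cubic_a ^ 8 * cubic_C ^ 2
      + 36531648 * cubic_a ^ 5 * cubic_C ^ 3 + 136048896 * cubic_a ^ 2 * cubic_C ^ 4) * cubic_Z"
  have "5 dvd qd G"
  proof -
    \<comment> \<open>The exponent 10 and the coefficients 45 and 35 in \<open>qd_Z\<close> give the
      factor 5; only \<open>qd hasse\<close> needs a congruence.\<close>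
    have "qd G = 5 * (2 * cubic_a ^ 9 * qd cubic_a * hasse * cubic_Z
        + cubic_a ^ 10 * hasse * ((9 * dil3 euler_log - 7 * euler_log) * cubic_Z))
        + qd hasse * (cubic_a ^ 10 * cubic_Z)"
      by (simp add: G_def qd_Z) algebra
    then show ?thesis
      using dvd_add[OF dvd_triv_left dvd_mult2[OF qd_hasse_cong]] by metis
  qed
  then have "5 dvd int m * G $ m"
    by (simp add: numeral_dvd_fps_iff qd_nth)
  moreover have "coprime 5 (int m)"
    using assms by (intro prime_imp_coprime) (auto simp: int_dvd_int_iff[of 5, simplified])
  ultimately have "5 dvd G $ m"
    by (simp add: coprime_dvd_mult_right_iff)
  then obtain g where g: "G $ m = 5 * g" ..
  have "(12 * int m + 5) ^ 3 * (cubic_Y * cubic_Z) $ m = 125 * (2 * G $ m + 5 * R $ m)"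
    using arg_cong[OF triple_derivative, of "\<lambda>f. f $ m"]
    unfolding G_def[symmetric] R_def[symmetric] derivative_nth
    by (simp only: numeral_mult_nth fps_add_nth power3_eq_cube mult.assoc)
  also have "\<dots> = 625 * (2 * g + R $ m)"
    by (simp add: g)
  finally have "625 dvd (12 * int m + 5) ^ 3 * (cubic_Y * cubic_Z) $ m"
    by simp
  moreover have "coprime (5 ^ 4) ((12 * int m + 5) ^ 3)"
  proof -
    \<comment> \<open>Modulo 5 this number is \<open>2 * m\<close>.\<close>
    have "\<not> 5 dvd 12 * int m + 5"
      using assms by presburger
    then have "coprime 5 (12 * int m + 5)"
      by (intro prime_imp_coprime) auto
    then show ?thesis
      by (simp only: coprime_power_left_iff coprime_power_right_iff simp_thms)
  qed
  ultimately show ?thesis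
    by (simp add: coprime_dvd_mult_right_iff)
qed

theorem theorem3p1:
  fixes a :: "nat \<Rightarrow> int" and n :: nat
  assumes "(\<lambda>k. 1 / ((1 - fps_X ^ (3 * (k + 1))) * (1 - fps_X ^ (k + 1)) ^ 3))
             has_prod (Abs_fps (\<lambda>m. of_int (a m)) :: rat fps)"
    and "[n = 13] (mod 45) \<or> [n = 22] (mod 45) \<or> [n = 31] (mod 45) \<or> [n = 40] (mod 45)"
  shows "[a n = 0] (mod 625)"
proof -
  \<comment> \<open>The four residues are \<open>9 * r + 4\<close> with \<open>r\<close> from 1 to
    4. Hence \<open>n = 9 * m + 4\<close>, with \<open>m\<close> congruent to \<open>r\<close>
    modulo 5.\<close>
  have "n mod 45 \<in> {13, 22, 31, 40}"
    using assms(2) by (auto simp: cong_def)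
  then obtain r where r: "n mod 45 = 9 * r + 4" "r \<in> {1, 2, 3, 4}"
    by fastforce
  define m where "m = 5 * (n div 45) + r"
  have n: "n = 3 * (3 * m + 1) + 1"
    using r(1) div_mult_mod_eq[of n 45] by (simp add: m_def)
  have "m mod 5 = r mod 5"
    by (simp add: m_def)
  then have "\<not> 5 dvd m"
    using r(2) by (auto simp: dvd_eq_mod_eq_0)
  have "a n = (euler_inv ^ 3 * dil3 euler_inv) $ n"
    using gen_fun_eq_euler_inv[OF assms(1)] by (metis fps_nth_Abs_fps)
  also have "\<dots> = 27 * (cubic_Y * cubic_Z) $ m"
    unfolding n gen_fun_nth_3 gen_fun_nth_9 by simp
  finally show ?thesis
    using YZ_coeff_cong[OF \<open>\<not> 5 dvd m\<close>] by (simp add: cong_0_iff)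
qed

end
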